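(* Let $X$ be a compact Hausdorff space with $X=X_1\cup X_2$, where each of the subspaces $X_1$ and $X_2$ has a $\sigma$-strongly point-finite (respectively, $\sigma$-boundedly point-finite) base. Then $\mathrm{cl}_X(X_1)\cap \mathrm{cl}_X(X_2)$ is metrizable and $X$ is an Eberlein compact (respectively, a uniform Eberlein compact).
   Context: An Eberlein compact is a compact Hausdorff space homeomorphic to a weakly compact subset of a Banach space; a uniform Eberlein compact is a compact Hausdorff space homeomorphic to a weakly compact subset of a Hilbert space. A family $\mathcal{U}$ of subsets of a set is strongly point-finite if every countably infinite subfamily of $\mathcal{U}$ contains a finite subfamily with empty intersection. The order $ord(\mathcal{U})$ is the largest integer $n$ such that $\mathcal{U}$ contains $n+1$ members with non-empty intersection (or $\infty$ if none exists); $\mathcal{U}$ is boundedly point-finite if its order is finite. A family is $\sigma$-strongly point-finite (resp. $\sigma$-boundedly point-finite) if it is a union of countably many strongly point-finite (resp. boundedly point-finite) families. *)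

theory Defs
  imports "HOL-Analysis.Analysis"
begin

definition is_base :: "'a topology \<Rightarrow> 'a set set \<Rightarrow> bool" where
  "is_base T B \<longleftrightarrow> (\<forall>U\<in>B. openin T U) \<and>
     (\<forall>U x. openin T U \<and> x \<in> U \<longrightarrow> (\<exists>W\<in>B. x \<in> W \<and> W \<subseteq> U))"

definition strongly_point_finite :: "'a set set \<Rightarrow> bool" where
  "strongly_point_finite \<U> \<longleftrightarrow>
     (\<forall>\<C>. \<C> \<subseteq> \<U> \<and> countable \<C> \<and> infinite \<C> \<longrightarrow>
        (\<exists>\<F>. \<F> \<subseteq> \<C> \<and> finite \<F> \<and> \<F> \<noteq> {} \<and> \<Inter>\<F> = {}))"

definition boundedly_point_finite :: "'a set set \<Rightarrow> bool" where
  "boundedly_point_finite \<U> \<longleftrightarrow>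
     (\<exists>n::nat. \<forall>\<F>. \<F> \<subseteq> \<U> \<and> finite \<F> \<and> card \<F> = n + 1 \<longrightarrow> \<Inter>\<F> = {})"

definition sigma_strongly_point_finite :: "'a set set \<Rightarrow> bool" where
  "sigma_strongly_point_finite \<U> \<longleftrightarrow>
     (\<exists>G :: nat \<Rightarrow> 'a set set. \<U> = (\<Union>n. G n) \<and> (\<forall>n. strongly_point_finite (G n)))"

definition sigma_boundedly_point_finite :: "'a set set \<Rightarrow> bool" where
  "sigma_boundedly_point_finite \<U> \<longleftrightarrow>
     (\<exists>G :: nat \<Rightarrow> 'a set set. \<U> = (\<Union>n. G n) \<and> (\<forall>n. boundedly_point_finite (G n)))"

definition real_vector_space_on ::
  "'v set \<Rightarrow> ('v \<Rightarrow> 'v \<Rightarrow> 'v) \<Rightarrow> (real \<Rightarrow> 'v \<Rightarrow> 'v) \<Rightarrow> 'v \<Rightarrow> bool" where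
  "real_vector_space_on V add smul z \<longleftrightarrow>
     z \<in> V \<and> (\<forall>x\<in>V. \<forall>y\<in>V. add x y \<in> V) \<and> (\<forall>a. \<forall>x\<in>V. smul a x \<in> V) \<and>
     (\<forall>x\<in>V. \<forall>y\<in>V. \<forall>w\<in>V. add (add x y) w = add x (add y w)) \<and>
     (\<forall>x\<in>V. \<forall>y\<in>V. add x y = add y x) \<and>
     (\<forall>x\<in>V. add z x = x) \<and>
     (\<forall>x\<in>V. add x (smul (-1) x) = z) \<and>
     (\<forall>a b. \<forall>x\<in>V. smul (a + b) x = add (smul a x) (smul b x)) \<and>
     (\<forall>a. \<forall>x\<in>V. \<forall>y\<in>V. smul a (add x y) = add (smul a x) (smul a y)) \<and>
     (\<forall>a b. \<forall>x\<in>V. smul a (smul b x) = smul (a * b) x) \<and>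
     (\<forall>x\<in>V. smul 1 x = x)"

definition banach_space_on ::
  "'v set \<Rightarrow> ('v \<Rightarrow> 'v \<Rightarrow> 'v) \<Rightarrow> (real \<Rightarrow> 'v \<Rightarrow> 'v) \<Rightarrow> 'v \<Rightarrow> ('v \<Rightarrow> real) \<Rightarrow> bool" where
  "banach_space_on V add smul z nrm \<longleftrightarrow>
     real_vector_space_on V add smul z \<and>
     (\<forall>x\<in>V. 0 \<le> nrm x) \<and> (\<forall>x\<in>V. nrm x = 0 \<longleftrightarrow> x = z) \<and>
     (\<forall>a. \<forall>x\<in>V. nrm (smul a x) = \<bar>a\<bar> * nrm x) \<and>
     (\<forall>x\<in>V. \<forall>y\<in>V. nrm (add x y) \<le> nrm x + nrm y) \<and>
     (\<forall>s. (\<forall>n. s n \<in> V) \<and>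
          (\<forall>e>0. \<exists>N. \<forall>m\<ge>N. \<forall>n\<ge>N. nrm (add (s m) (smul (-1) (s n))) < e) \<longrightarrow>
          (\<exists>l\<in>V. (\<lambda>n. nrm (add (s n) (smul (-1) l))) \<longlonglongrightarrow> 0))"

definition hilbert_space_on ::
  "'v set \<Rightarrow> ('v \<Rightarrow> 'v \<Rightarrow> 'v) \<Rightarrow> (real \<Rightarrow> 'v \<Rightarrow> 'v) \<Rightarrow> 'v \<Rightarrow> ('v \<Rightarrow> 'v \<Rightarrow> real) \<Rightarrow> bool" where
  "hilbert_space_on V add smul z ip \<longleftrightarrow>
     real_vector_space_on V add smul z \<and>
     (\<forall>x\<in>V. \<forall>y\<in>V. ip x y = ip y x) \<and>
     (\<forall>x\<in>V. \<forall>y\<in>V. \<forall>w\<in>V. ip (add x y) w = ip x w + ip y w) \<and>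
     (\<forall>a. \<forall>x\<in>V. \<forall>y\<in>V. ip (smul a x) y = a * ip x y) \<and>
     (\<forall>x\<in>V. 0 \<le> ip x x) \<and> (\<forall>x\<in>V. ip x x = 0 \<longleftrightarrow> x = z) \<and>
     banach_space_on V add smul z (\<lambda>x. sqrt (ip x x))"

definition dual_space_on ::
  "'v set \<Rightarrow> ('v \<Rightarrow> 'v \<Rightarrow> 'v) \<Rightarrow> (real \<Rightarrow> 'v \<Rightarrow> 'v) \<Rightarrow> ('v \<Rightarrow> real) \<Rightarrow> ('v \<Rightarrow> real) set" where
  "dual_space_on V add smul nrm =
     {f. (\<forall>x\<in>V. \<forall>y\<in>V. f (add x y) = f x + f y) \<and> (\<forall>a. \<forall>x\<in>V. f (smul a x) = a * f x) \<and>
         (\<exists>C. \<forall>x\<in>V. \<bar>f x\<bar> \<le> C * nrm x)}"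

definition weak_topology_on ::
  "'v set \<Rightarrow> ('v \<Rightarrow> 'v \<Rightarrow> 'v) \<Rightarrow> (real \<Rightarrow> 'v \<Rightarrow> 'v) \<Rightarrow> ('v \<Rightarrow> real) \<Rightarrow> 'v topology" where
  "weak_topology_on V add smul nrm =
     topology_generated_by
       (insert V {{x \<in> V. f x \<in> U} | f U. f \<in> dual_space_on V add smul nrm \<and> open U})"

definition eberlein_compact :: "'a topology \<Rightarrow> bool" where
  "eberlein_compact X \<longleftrightarrow>
     (\<exists>(V :: (nat \<times> 'a set \<Rightarrow> real) set) add smul z nrm K.
        banach_space_on V add smul z nrm \<and> K \<subseteq> V \<and>
        compactin (weak_topology_on V add smul nrm) K \<and>
        X homeomorphic_space subtopology (weak_topology_on V add smul nrm) K)"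

definition uniform_eberlein_compact :: "'a topology \<Rightarrow> bool" where
  "uniform_eberlein_compact X \<longleftrightarrow>
     (\<exists>(V :: (nat \<times> 'a set \<Rightarrow> real) set) add smul z ip K.
        hilbert_space_on V add smul z ip \<and> K \<subseteq> V \<and>
        compactin (weak_topology_on V add smul (\<lambda>x. sqrt (ip x x))) K \<and>
        X homeomorphic_space
          subtopology (weak_topology_on V add smul (\<lambda>x. sqrt (ip x x))) K)"

end

(*
  Each open set of a subspace Y extends to the largest open set of X with that trace, and by density
  of Y in cl Y a strongly point-finite family stays strongly point-finite on cl Y after extension.
  The extended bases of X1 and X2 together therefore give a point-countable base of the compact set
  cl X1 \<inter> cl X2, which is metrizable by Mishchenko's lemma.

  A point outside this set lies, say, in X - cl X2, an open set contained in X1. A basic set U of X1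
  with cl U \<subseteq> X - cl X2 is open in X and, cl U being metrizable by Mishchenko's lemma again, an
  F_sigma, so countably many Urysohn functions supported in U detect it. Together with countably many
  functions separating the points of cl X1 \<inter> cl X2 this is a separating family whose supports are
  sigma-point-finite, respectively sigma-boundedly point-finite. After scaling by level it maps X
  injectively into c_0, respectively l^2, continuously for the weak topology.
*)
theory Submission
  imports Defs
begin

section \<open>Point-countable bases and separating functions\<close>

text \<open>The obstacle is that the base sets of \<open>X1\<close> and \<open>X2\<close> are open
  only in subspaces that need be neither open nor closed. Their extensions to X are uncontrolled off
  the closure of the subspace, and at closure points outside the subspace the base says nothing
  about neighbourhoods. On the common closure both families are controlled at once and each point
  belongs to \<open>X1\<close> or \<open>X2\<close>, so metrizability is available there. The two
  cases share one construction. The separating family records which given family contains its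
  supports, and point-finiteness or a bound on the order is read off at the end. The functions for
  the common closure may be non-zero anywhere, so they get levels of their own, with the one-member
  family of the whole space. The duals of c_0 and l^2 are never described. Weak continuity of a
  bounded, coordinatewise continuous map follows from one estimate valid for both: a bounded
  functional is small on the part of the unit ball that vanishes on a suitable finite set.\<close>

lemma regular_space_closure_shrink:
  assumes "regular_space X" "openin X U" "x \<in> U"
  obtains V where "openin X V" "x \<in> V" "X closure_of V \<subseteq> U"
proof -
  have "closedin X (topspace X - U)" "x \<in> topspace X - (topspace X - U)"
    using assms openin_subset by fastforce+
  then obtain V where "openin X V" "x \<in> V" "disjnt (topspace X - U) (X closure_of V)"
    using assms(1) unfolding regular_space by meson
  moreover have "X closure_of V \<subseteq> topspace X"
    by (rule closure_of_subset_topspace)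
  ultimately show ?thesis
    by (intro that[of V]) (auto simp: disjnt_iff)
qed

lemma is_base_openin: "is_base T B \<Longrightarrow> U \<in> B \<Longrightarrow> openin T U"
  by (simp add: is_base_def)

lemma is_baseE:
  assumes "is_base T B" "openin T U" "x \<in> U"
  obtains W where "W \<in> B" "x \<in> W" "W \<subseteq> U"
  using assms unfolding is_base_def by meson

lemma is_base_trace:
  assumes "is_base (subtopology X Y) B" "S \<subseteq> Y"
  shows "is_base (subtopology X S) ((\<lambda>W. W \<inter> S) ` B)"
  unfolding is_base_def
proof (intro conjI ballI allI impI)
  fix U assume "U \<in> (\<lambda>W. W \<inter> S) ` B"
  then obtain W where W: "W \<in> B" "U = W \<inter> S" by auto
  then obtain T where "openin X T" "W = T \<inter> Y"
    using is_base_openin[OF assms(1)] openin_subtopology[of X Y W] by auto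
  then have "openin X T" "U = T \<inter> S" using W assms(2) by auto
  then show "openin (subtopology X S) U" unfolding openin_subtopology by blast
next
  fix U x assume "openin (subtopology X S) U \<and> x \<in> U"
  then obtain T where T: "openin X T" "U = T \<inter> S" "x \<in> T" "x \<in> S"
    unfolding openin_subtopology by auto
  then have "openin (subtopology X Y) (T \<inter> Y)" "x \<in> T \<inter> Y"
    using assms(2) by (auto simp: openin_subtopology)
  then obtain W where "W \<in> B" "x \<in> W" "W \<subseteq> T \<inter> Y"
    by (rule is_baseE[OF assms(1)])
  then show "\<exists>V\<in>(\<lambda>W. W \<inter> S) ` B. x \<in> V \<and> V \<subseteq> U"
    using T by (intro bexI[of _ "W \<inter> S"]) auto
qed

text \<open>
  Mishchenko's lemma. Fix a point \<open>p R\<close> missed by each non-covering finite \<open>R\<close>. Growing families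
  from \<open>{}\<close> by adding a member through the current missed point gives countable branching, and
  every cover of least cardinality is reached along some branch.
\<close>

lemma countable_base_if_point_countable:
  assumes cpt: "compact_space K" and t1: "t1_space K" and base: "is_base K B"
    and ptc: "\<And>x. x \<in> topspace K \<Longrightarrow> countable {U \<in> B. x \<in> U}"
  shows "countable B"
proof -
  define p where "p R = (SOME x. x \<in> topspace K - \<Union>R)" for R
  define C where "C k = ((\<lambda>\<C>. \<Union>R\<in>\<C>. (\<lambda>U. insert U R) ` {U \<in> B. p R \<in> U}) ^^ k) {{}}" for k
  have C0: "C 0 = {{}}"
    and CSuc: "C (Suc k) = (\<Union>R\<in>C k. (\<lambda>U. insert U R) ` {U \<in> B. p R \<in> U})" for k
    by (simp_all add: C_def)
  have opn: "openin K U" if "U \<in> B" for U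
    using is_base_openin[OF base that] .
  \<comment> \<open>\<open>p R\<close> is unspecified when \<open>R\<close> covers the space, so
    countable branching is needed at every value of the type.\<close>
  have ptc': "countable {U \<in> B. x \<in> U}" for x
  proof (cases "x \<in> topspace K")
    case False
    then have "{U \<in> B. x \<in> U} = {}" using opn openin_subset by blast
    then show ?thesis by (simp only: countable_empty)
  qed (rule ptc)
  have cntC: "countable (C k)" for k
    by (induction k) (auto simp: C0 CSuc ptc' intro!: countable_UN countable_image)
  have finC: "finite R" if "R \<in> C k" for R k
    using that by (induction k arbitrary: R) (auto simp: C0 CSuc)
  have cnt: "countable (\<Union>k. \<Union>(C k))"
  proof (intro countable_UN countableI_type)
    have "countable (\<Union>R\<in>C k. R)" for k
      using finC by (intro countable_UN cntC countable_finite)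
    then show "countable (\<Union>(C k))" for k by simp
  qed
  have "B \<subseteq> insert {} (\<Union>k. \<Union>(C k))"
  proof
    fix U assume U: "U \<in> B"
    show "U \<in> insert {} (\<Union>k. \<Union>(C k))"
    proof (cases "U = {}")
      case False
      then obtain x where x: "x \<in> U" by auto
      then have xK: "x \<in> topspace K" using U opn openin_subset by blast
      \<comment> \<open>\<open>U\<close> is the only member of \<open>\<V>\<close> containing x, so
        every subcover contains \<open>U\<close>; by T1 the other members cover everything except
        x.\<close>
      define \<V> where "\<V> = insert U {V \<in> B. x \<notin> V}"
      have "topspace K \<subseteq> \<Union>\<V>"
      proof
        fix y assume y: "y \<in> topspace K"
        show "y \<in> \<Union>\<V>"
        proof (cases "y = x")
          case True then show ?thesis using x by (auto simp: \<V>_def)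
        next
          case False
          then obtain W where W: "openin K W" "y \<in> W" "x \<notin> W"
            using t1 y xK False unfolding t1_space_def by meson
          obtain V where "V \<in> B" "y \<in> V" "V \<subseteq> W"
            by (rule is_baseE[OF base W(1,2)])
          then show ?thesis using W(3) by (auto simp: \<V>_def)
        qed
      qed
      moreover have "\<forall>V\<in>\<V>. openin K V" using U opn by (auto simp: \<V>_def)
      ultimately obtain \<D>0 where "finite \<D>0 \<and> \<D>0 \<subseteq> \<V> \<and> topspace K \<subseteq> \<Union>\<D>0"
        using cpt unfolding compact_space_alt by meson
      from ex_has_least_nat[where P = "\<lambda>\<D>. finite \<D> \<and> \<D> \<subseteq> \<V> \<and> topspace K \<subseteq> \<Union>\<D>",
          OF this, of card]
      obtain \<D> where D: "finite \<D>" "\<D> \<subseteq> \<V>" "topspace K \<subseteq> \<Union>\<D>"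
        and least: "\<And>\<E>. finite \<E> \<and> \<E> \<subseteq> \<V> \<and> topspace K \<subseteq> \<Union>\<E> \<Longrightarrow> card \<D> \<le> card \<E>"
        by blast
      have "\<exists>R\<in>C k. R \<subseteq> \<D> \<and> card R = k" if "k \<le> card \<D>" for k
        using that
      proof (induction k)
        case 0 then show ?case by (simp add: C0)
      next
        case (Suc k)
        then obtain R where R: "R \<in> C k" "R \<subseteq> \<D>" "card R = k" by auto
        \<comment> \<open>By leastness, fewer than \<open>card \<D>\<close> members of
          \<open>\<V>\<close> cannot cover, so \<open>p R\<close> is truly missed. The member of
          \<open>\<D>\<close> through it is new and continues the branch inside
          \<open>\<D>\<close>.\<close>
        have "\<not> topspace K \<subseteq> \<Union>R"
          using least[of R] R Suc.prems D finite_subset[OF R(2)] by auto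
        then have "\<exists>z. z \<in> topspace K - \<Union>R" by auto
        then have pR: "p R \<in> topspace K - \<Union>R" unfolding p_def by (rule someI_ex)
        then obtain V where V: "V \<in> \<D>" "p R \<in> V" using D by auto
        then have "V \<in> B" using D U by (auto simp: \<V>_def)
        then have "insert V R \<in> C (Suc k)" using V R by (auto simp: CSuc)
        moreover have "card (insert V R) = Suc k"
          using pR V R D finite_subset[OF R(2)] by (subst card_insert_disjoint) auto
        ultimately show ?case using V R by blast
      qed
      then obtain R where R: "R \<in> C (card \<D>)" "R \<subseteq> \<D>" "card R = card \<D>" by blast
      then have "R = \<D>" using D by (simp add: card_subset_eq)
      moreover have "U \<in> \<D>" using D xK by (auto simp: \<V>_def)
      ultimately show ?thesis using R by blast
    qed simp
  qed
  then show ?thesis by (rule countable_subset) (intro countable_insert cnt)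
qed

text \<open>A pair of base sets with the closure of the first inside the second yields a Urysohn
  function that is 0 on that closure and 1 on the rest of F. Regularity makes these functions
  separate points of F, and Mishchenko's lemma makes them countably many. They are continuous on all
  of X, so they can serve as coordinates later.\<close>

lemma countable_separating_functions:
  assumes cpt: "compact_space X" and haus: "Hausdorff_space X" and F: "closedin X F"
    and base: "is_base (subtopology X F) B"
    and ptc: "\<And>x. x \<in> F \<Longrightarrow> countable {U \<in> B. x \<in> U}"
  obtains g :: "nat \<Rightarrow> 'a \<Rightarrow> real"
  where "\<And>n. continuous_map X (top_of_set {0..1}) (g n)"
    and "\<And>x y. x \<in> F \<Longrightarrow> y \<in> F \<Longrightarrow> x \<noteq> y \<Longrightarrow> \<exists>n. g n x \<noteq> g n y"
proof -
  have FX: "F \<subseteq> topspace X" using F closedin_subset by blast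
  have norm: "normal_space X"
    using compact_Hausdorff_or_regular_imp_normal_space cpt haus by blast
  have reg: "regular_space (subtopology X F)"
    using compact_Hausdorff_imp_regular_space[OF cpt haus] regular_space_subtopology by blast
  have t1: "t1_space (subtopology X F)"
    using haus Hausdorff_imp_t1_space Hausdorff_space_subtopology by blast
  have "compact_space (subtopology X F)"
    using closedin_compact_space[OF cpt F] compact_space_subtopology by blast
  then have cB: "countable B"
    using countable_base_if_point_countable[OF _ t1 base] ptc FX by (simp add: Int_absorb1)
  \<comment> \<open>The default is the constant 0, so every pair of sets gets a continuous function
    and all of \<open>B \<times> B\<close> can be enumerated, suitable or not.\<close>
  have "\<exists>f. continuous_map X (top_of_set {0..1::real}) f \<and>
      (closedin X P \<and> closedin X Q \<and> disjnt P Q \<longrightarrow> f ` P \<subseteq> {0} \<and> f ` Q \<subseteq> {1})" for P Q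
  proof (cases "closedin X P \<and> closedin X Q \<and> disjnt P Q")
    case True
    then show ?thesis using Urysohn_lemma[OF norm, of P Q 0 1] by (metis zero_le_one)
  next
    case False
    then show ?thesis by (intro exI[of _ "\<lambda>_. 0"]) (use False in auto)
  qed
  then obtain G where G: "\<And>P Q. continuous_map X (top_of_set {0..1::real}) (G P Q)"
    "\<And>P Q. closedin X P \<and> closedin X Q \<and> disjnt P Q \<Longrightarrow> G P Q ` P \<subseteq> {0} \<and> G P Q ` Q \<subseteq> {1}"
    by metis
  define h where "h W = G (X closure_of (fst W)) (F - snd W)" for W
  define g where "g n = h (from_nat_into (B \<times> B) n)" for n
  show ?thesis
  proof
    show "continuous_map X (top_of_set {0..1}) (g n)" for n
      unfolding g_def h_def by (rule G)
    fix x y assume xy: "x \<in> F" "y \<in> F" "x \<noteq> y"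
    then have "x \<in> topspace (subtopology X F)" "y \<in> topspace (subtopology X F)"
      using FX by auto
    then have "\<exists>O'. openin (subtopology X F) O' \<and> x \<in> O' \<and> y \<notin> O'"
      using t1 xy(3) unfolding t1_space_def by blast
    then obtain O' where O': "openin (subtopology X F) O'" "x \<in> O'" "y \<notin> O'"
      by blast
    obtain V where V: "V \<in> B" "x \<in> V" "V \<subseteq> O'"
      by (rule is_baseE[OF base O'(1,2)])
    then have oV: "openin (subtopology X F) V" using is_base_openin[OF base] by blast
    obtain N where N: "openin (subtopology X F) N" "x \<in> N" "subtopology X F closure_of N \<subseteq> V"
      by (rule regular_space_closure_shrink[OF reg oV V(2)])
    obtain U where U: "U \<in> B" "x \<in> U" "U \<subseteq> N"
      by (rule is_baseE[OF base N(1,2)])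
    have NF: "N \<subseteq> F" using N openin_subset by fastforce
    have "X closure_of U \<subseteq> F" using U NF F closure_of_minimal by (metis order_trans)
    moreover have "X closure_of U \<subseteq> X closure_of N" using U closure_of_mono by blast
    ultimately have "X closure_of U \<subseteq> V"
      using N(3) NF by (auto simp: closure_of_subtopology Int_absorb1)
    moreover have "closedin X (F - V)"
      using oV F by (metis closedin_closed_subtopology closedin_diff closedin_topspace
          openin_closedin_eq topspace_subtopology_subset FX)
    ultimately have "h (U, V) ` (X closure_of U) \<subseteq> {0}" "h (U, V) ` (F - V) \<subseteq> {1}"
      using G(2)[of "X closure_of U" "F - V"] by (auto simp: h_def disjnt_iff)
    moreover have "x \<in> X closure_of U"
      using U NF FX closure_of_subset[of U X] by auto
    moreover have "y \<in> F - V" using xy O' V by blast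
    ultimately have "h (U, V) x = 0" "h (U, V) y = 1" by blast+
    then have "h (U, V) x \<noteq> h (U, V) y" by simp
    moreover obtain n where "from_nat_into (B \<times> B) n = (U, V)"
      using from_nat_into_surj[of "B \<times> B" "(U, V)"] cB U V by auto
    ultimately show "\<exists>n. g n x \<noteq> g n y" unfolding g_def by metis
  qed
qed

text \<open>Countably many separating functions map the compact set F injectively into a countable
  product of lines, and a continuous injection of a compact space into a Hausdorff space is an
  embedding.\<close>

lemma metrizable_if_point_countable_base:
  assumes cpt: "compact_space X" and haus: "Hausdorff_space X" and F: "closedin X F"
    and base: "is_base (subtopology X F) B"
    and ptc: "\<And>x. x \<in> F \<Longrightarrow> countable {U \<in> B. x \<in> U}"
  shows "metrizable_space (subtopology X F)"
proof -
  obtain g :: "nat \<Rightarrow> 'a \<Rightarrow> real"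
    where g: "\<And>n. continuous_map X (top_of_set {0..1}) (g n)"
      and sep: "\<And>x y. x \<in> F \<Longrightarrow> y \<in> F \<Longrightarrow> x \<noteq> y \<Longrightarrow> \<exists>n. g n x \<noteq> g n y"
    using countable_separating_functions[OF assms] by blast
  let ?P = "product_topology (\<lambda>n::nat. euclideanreal) UNIV"
  have "continuous_map X euclideanreal (g n)" for n
    using g continuous_map_into_fulltopology by blast
  then have "continuous_map (subtopology X F) ?P (\<lambda>x n. g n x)"
    by (simp add: continuous_map_componentwise_UNIV continuous_map_from_subtopology)
  moreover have "compact_space (subtopology X F)"
    using closedin_compact_space[OF cpt F] compact_space_subtopology by blast
  moreover have metr: "metrizable_space ?P"
    by (auto simp: metrizable_space_product_topology metrizable_space_euclidean)
  moreover have "inj_on (\<lambda>x n. g n x) (topspace (subtopology X F))"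
    using sep by (fastforce simp: inj_on_def fun_eq_iff)
  ultimately have "embedding_map (subtopology X F) ?P (\<lambda>x n. g n x)"
    using continuous_imp_embedding_map metrizable_imp_Hausdorff_space by blast
  then show ?thesis
    using embedding_map_imp_homeomorphic_space homeomorphic_metrizable_space
      metrizable_space_subtopology[OF metr] by blast
qed

text \<open>An infinite \<open>\<C>\<close> would contain a countably infinite family, hence a
  finite one with empty intersection. The hypothesis \<open>fip\<close> asks for no single common
  point, because extended sets meeting at a closure point yield a common point of the original sets
  that varies with the finite subfamily.\<close>

lemma strongly_point_finite_at:
  assumes "strongly_point_finite G"
    and fip: "\<And>\<F>. \<F> \<subseteq> \<C> \<Longrightarrow> finite \<F> \<Longrightarrow> \<F> \<noteq> {} \<Longrightarrow> \<Inter>\<F> \<noteq> {}"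
    and "\<C> \<subseteq> G"
  shows "finite \<C>"
proof (rule ccontr)
  assume "infinite \<C>"
  then obtain D where "countable D" "infinite D" "D \<subseteq> \<C>"
    using infinite_countable_subset' by blast
  moreover from this obtain \<F> where "\<F> \<subseteq> D" "finite \<F>" "\<F> \<noteq> {}" "\<Inter>\<F> = {}"
    using assms(1,3) unfolding strongly_point_finite_def by (metis order_trans)
  ultimately show False using fip by (meson order_trans)
qed

lemma strongly_point_finite_imp_point_finite:
  "strongly_point_finite G \<Longrightarrow> finite {U \<in> G. x \<in> U}"
  by (rule strongly_point_finite_at) auto

text \<open>Any \<open>n + 1\<close> members of an infinite subfamily already have empty
  intersection. This lets the uniform case reuse the construction of the other case.\<close>

lemma boundedly_imp_strongly_point_finite:
  assumes "boundedly_point_finite G"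
  shows "strongly_point_finite G"
  unfolding strongly_point_finite_def
proof (intro allI impI)
  obtain n where n: "\<And>\<F>. \<F> \<subseteq> G \<Longrightarrow> finite \<F> \<Longrightarrow> card \<F> = n + 1 \<Longrightarrow> \<Inter>\<F> = {}"
    using assms unfolding boundedly_point_finite_def by blast
  fix \<C> assume C: "\<C> \<subseteq> G \<and> countable \<C> \<and> infinite \<C>"
  then obtain \<F> where "finite \<F>" "\<F> \<subseteq> \<C>" "card \<F> = n + 1"
    using infinite_arbitrarily_large[of \<C> "n + 1"] by blast
  then show "\<exists>\<F>\<subseteq>\<C>. finite \<F> \<and> \<F> \<noteq> {} \<and> \<Inter>\<F> = {}"
    using n C by (intro exI[of _ \<F>]) auto
qed

section \<open>Extending open sets from a subspace to its closure\<close>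

definition largest_extension :: "'a topology \<Rightarrow> 'a set \<Rightarrow> 'a set \<Rightarrow> 'a set" where
  "largest_extension X Y U = topspace X - X closure_of (Y - U)"

lemma openin_largest_extension [simp]: "openin X (largest_extension X Y U)"
  by (simp add: largest_extension_def openin_diff)

lemma largest_extension_trace:
  assumes "openin (subtopology X Y) U" "Y \<subseteq> topspace X"
  shows "largest_extension X Y U \<inter> Y = U"
proof -
  obtain T where T: "openin X T" "U = T \<inter> Y"
    using assms(1) unfolding openin_subtopology by blast
  then have "X closure_of (Y - U) \<subseteq> topspace X - T"
    using assms(2) by (intro closure_of_minimal) auto
  moreover have "Y - U \<subseteq> X closure_of (Y - U)"
    using assms(2) by (intro closure_of_subset) auto
  ultimately show ?thesis using T assms(2) by (auto simp: largest_extension_def)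
qed

text \<open>Every neighbourhood of z inside the extension meets \<open>Y\<close> by density, and it
  does so in the trace \<open>U\<close>. This makes up for the lost control on size: if the closure
  of \<open>U\<close> is small, the extension is small on the closure of \<open>Y\<close>.\<close>

lemma largest_extension_closure:
  assumes "openin (subtopology X Y) U" "Y \<subseteq> topspace X"
  shows "largest_extension X Y U \<inter> X closure_of Y \<subseteq> X closure_of U"
proof
  fix z assume z: "z \<in> largest_extension X Y U \<inter> X closure_of Y"
  have "\<exists>y. y \<in> U \<and> y \<in> T" if T: "z \<in> T" "openin X T" for T
  proof -
    have "openin X (T \<inter> largest_extension X Y U)" using T by (simp add: openin_Int)
    moreover have "z \<in> T \<inter> largest_extension X Y U" "z \<in> X closure_of Y" using z T by auto
    ultimately obtain y where "y \<in> Y" "y \<in> T \<inter> largest_extension X Y U"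
      unfolding in_closure_of by meson
    then show ?thesis using largest_extension_trace[OF assms] by blast
  qed
  then show "z \<in> X closure_of U" using z by (auto simp: in_closure_of)
qed

text \<open>
  Finitely many extended sets sharing a point of the closure share a point of \<open>Y\<close>, by density.
\<close>

lemma finite_largest_extension:
  assumes spf: "strongly_point_finite G" and opn: "\<And>U. U \<in> G \<Longrightarrow> openin (subtopology X Y) U"
    and Y: "Y \<subseteq> topspace X" and z: "z \<in> X closure_of Y"
  shows "finite {U \<in> G. z \<in> largest_extension X Y U}"
proof (rule strongly_point_finite_at[OF spf])
  fix \<F> assume F: "\<F> \<subseteq> {U \<in> G. z \<in> largest_extension X Y U}" "finite \<F>" "\<F> \<noteq> {}"
  let ?T = "\<Inter>(largest_extension X Y ` \<F>)"
  have "openin X ?T" using F by (intro openin_Inter) auto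
  moreover have "z \<in> ?T" using F by auto
  ultimately obtain y where y: "y \<in> Y" "y \<in> ?T" using z unfolding in_closure_of by meson
  have "y \<in> U" if "U \<in> \<F>" for U
    using largest_extension_trace[OF opn Y, of U] y F that by blast
  then show "\<Inter>\<F> \<noteq> {}" by blast
qed auto

text \<open>The last conclusion falls short of a base in two ways: it speaks only of points of
  \<open>Y\<close>, and it confines \<open>W\<close> only on the closure of \<open>Y\<close>, as an
  extended set may be large elsewhere.\<close>

lemma outer_base_on_closure:
  assumes reg: "regular_space X" and Y: "Y \<subseteq> topspace X"
    and base: "is_base (subtopology X Y) B" and spf: "sigma_strongly_point_finite B"
  obtains \<W> where "\<And>W. W \<in> \<W> \<Longrightarrow> openin X W"
    and "\<And>z. z \<in> X closure_of Y \<Longrightarrow> countable {W \<in> \<W>. z \<in> W}"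
    and "\<And>T y. openin X T \<Longrightarrow> y \<in> Y \<Longrightarrow> y \<in> T \<Longrightarrow>
           \<exists>W\<in>\<W>. y \<in> W \<and> W \<inter> X closure_of Y \<subseteq> T"
proof
  let ?E = "largest_extension X Y"
  have opn: "openin (subtopology X Y) U" if "U \<in> B" for U
    using is_base_openin[OF base that] .
  show "openin X W" if "W \<in> ?E ` B" for W using that by auto
  show "countable {W \<in> ?E ` B. z \<in> W}" if z: "z \<in> X closure_of Y" for z
  proof -
    obtain G :: "nat \<Rightarrow> 'a set set" where G: "B = (\<Union>n. G n)" "\<And>n. strongly_point_finite (G n)"
      using spf unfolding sigma_strongly_point_finite_def by blast
    have "finite {U \<in> G n. z \<in> ?E U}" for n
      using finite_largest_extension[OF G(2) _ Y z] opn G(1) by blast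
    then have "countable (\<Union>n. ?E ` {U \<in> G n. z \<in> ?E U})"
      by (intro countable_UN countableI_type countable_image) (rule countable_finite)
    moreover have "{W \<in> ?E ` B. z \<in> W} \<subseteq> (\<Union>n. ?E ` {U \<in> G n. z \<in> ?E U})"
      unfolding G(1) by auto
    ultimately show ?thesis by (rule countable_subset[rotated])
  qed
  fix T y assume T: "openin X T" "y \<in> Y" "y \<in> T"
  \<comment> \<open>Shrinking to \<open>V\<close> pays for passing from \<open>U\<close> to its
    closure, which is the bound available for the extended set.\<close>
  obtain V where V: "openin X V" "y \<in> V" "X closure_of V \<subseteq> T"
    by (rule regular_space_closure_shrink[OF reg T(1,3)])
  then obtain U where U: "U \<in> B" "y \<in> U" "U \<subseteq> V \<inter> Y"
    using is_baseE[OF base, of "V \<inter> Y" y] openin_subtopology_Int[OF V(1), of Y] V(2) T(2)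
    by blast
  have "X closure_of U \<subseteq> X closure_of V" using U by (intro closure_of_mono) auto
  then have "?E U \<inter> X closure_of Y \<subseteq> T"
    using largest_extension_closure[OF opn[OF U(1)] Y] V by blast
  moreover have "y \<in> ?E U" using largest_extension_trace[OF opn[OF U(1)] Y] U by blast
  ultimately show "\<exists>W\<in>?E ` B. y \<in> W \<and> W \<inter> X closure_of Y \<subseteq> T" using U by blast
qed

text \<open>A point of the intersection lies in \<open>Y1\<close> or in \<open>Y2\<close> and takes
  its small sets from the family on that side. As the intersection lies in both closures, both
  families are point-countable and confined on it.\<close>

lemma point_countable_base_on_common_closure:
  assumes reg: "regular_space X" and Y1: "Y1 \<subseteq> topspace X" and Y2: "Y2 \<subseteq> topspace X"
    and cover: "topspace X = Y1 \<union> Y2"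
    and B1: "is_base (subtopology X Y1) B1" "sigma_strongly_point_finite B1"
    and B2: "is_base (subtopology X Y2) B2" "sigma_strongly_point_finite B2"
  obtains B where "is_base (subtopology X (X closure_of Y1 \<inter> X closure_of Y2)) B"
    and "\<And>x. x \<in> X closure_of Y1 \<inter> X closure_of Y2 \<Longrightarrow> countable {U \<in> B. x \<in> U}"
proof -
  define F where "F = X closure_of Y1 \<inter> X closure_of Y2"
  obtain W1 where W1: "\<And>W. W \<in> W1 \<Longrightarrow> openin X W"
    "\<And>z. z \<in> X closure_of Y1 \<Longrightarrow> countable {W \<in> W1. z \<in> W}"
    "\<And>T y. openin X T \<Longrightarrow> y \<in> Y1 \<Longrightarrow> y \<in> T \<Longrightarrow> \<exists>W\<in>W1. y \<in> W \<and> W \<inter> X closure_of Y1 \<subseteq> T"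
    using outer_base_on_closure[OF reg Y1 B1] by blast
  obtain W2 where W2: "\<And>W. W \<in> W2 \<Longrightarrow> openin X W"
    "\<And>z. z \<in> X closure_of Y2 \<Longrightarrow> countable {W \<in> W2. z \<in> W}"
    "\<And>T y. openin X T \<Longrightarrow> y \<in> Y2 \<Longrightarrow> y \<in> T \<Longrightarrow> \<exists>W\<in>W2. y \<in> W \<and> W \<inter> X closure_of Y2 \<subseteq> T"
    using outer_base_on_closure[OF reg Y2 B2] by blast
  let ?B = "(\<lambda>W. W \<inter> F) ` (W1 \<union> W2)"
  have "is_base (subtopology X F) ?B"
    unfolding is_base_def
  proof (intro conjI ballI allI impI)
    fix U assume "U \<in> ?B"
    then show "openin (subtopology X F) U"
      using W1(1) W2(1) by (auto simp: openin_subtopology)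
  next
    fix U x assume "openin (subtopology X F) U \<and> x \<in> U"
    then obtain T where T: "openin X T" "U = T \<inter> F" "x \<in> T" "x \<in> F"
      unfolding openin_subtopology by auto
    then have "x \<in> Y1 \<or> x \<in> Y2" using cover openin_subset by blast
    then obtain W where W: "W \<in> W1 \<union> W2" "x \<in> W" "W \<inter> F \<subseteq> T"
    proof
      assume "x \<in> Y1"
      then obtain W where "W\<in>W1" "x \<in> W" "W \<inter> X closure_of Y1 \<subseteq> T" using W1(3) T by meson
      then show ?thesis by (intro that[of W]) (auto simp: F_def)
    next
      assume "x \<in> Y2"
      then obtain W where "W\<in>W2" "x \<in> W" "W \<inter> X closure_of Y2 \<subseteq> T" using W2(3) T by meson
      then show ?thesis by (intro that[of W]) (auto simp: F_def)
    qed
    then show "\<exists>V\<in>?B. x \<in> V \<and> V \<subseteq> U" using T by (intro bexI[of _ "W \<inter> F"]) auto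
  qed
  moreover have "countable {U \<in> ?B. x \<in> U}" if "x \<in> F" for x
  proof -
    have "countable ((\<lambda>W. W \<inter> F) ` ({W \<in> W1. x \<in> W} \<union> {W \<in> W2. x \<in> W}))"
      using W1(2) W2(2) that by (auto simp: F_def)
    then show ?thesis by (rule countable_subset[rotated]) auto
  qed
  ultimately show ?thesis using that[of ?B] unfolding F_def by blast
qed

text \<open>A Urysohn function vanishing off an open U is prescribed to be 1 only on a closed part
  of U; the index k runs through closed parts exhausting U. As y is arbitrary in X, a pair is
  separated as soon as one of its points lies in \<open>D\<close>.\<close>

lemma separating_functions_on_open:
  assumes cpt: "compact_space X" and haus: "Hausdorff_space X"
    and base: "is_base (subtopology X Y) B" and G: "B = (\<Union>n. G n)"
    and spf: "\<And>n::nat. strongly_point_finite (G n)"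
    and D: "openin X D" "D \<subseteq> Y"
  obtains \<phi> :: "nat \<Rightarrow> nat \<Rightarrow> 'a set \<Rightarrow> 'a \<Rightarrow> real"
  where "\<And>n k U. continuous_map X (top_of_set {0..1}) (\<phi> n k U)"
    and "\<And>n k U x. x \<in> topspace X \<Longrightarrow> \<phi> n k U x \<noteq> 0 \<Longrightarrow> U \<in> G n \<and> x \<in> U"
    and "\<And>x y. x \<in> D \<Longrightarrow> y \<in> topspace X \<Longrightarrow> y \<noteq> x \<Longrightarrow> \<exists>n k U. \<phi> n k U x \<noteq> \<phi> n k U y"
proof -
  have norm: "normal_space X"
    using compact_Hausdorff_or_regular_imp_normal_space cpt haus by blast
  have reg: "regular_space X" using compact_Hausdorff_imp_regular_space[OF cpt haus] .
  have opn: "openin (subtopology X Y) U" if "U \<in> B" for U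
    using is_base_openin[OF base that] .
  define good where "good U \<longleftrightarrow> U \<in> B \<and> X closure_of U \<subseteq> D" for U
  have openU: "openin X U" and UC: "U \<subseteq> X closure_of U" if gU: "good U" for U
  proof -
    have "U \<subseteq> topspace X"
      using opn[of U] gU openin_subset unfolding good_def by fastforce
    then show UC: "U \<subseteq> X closure_of U" by (rule closure_of_subset)
    obtain T where T: "openin X T" "U = T \<inter> Y"
      using opn[of U] gU unfolding good_def openin_subtopology by blast
    \<comment> \<open>Since U \<subseteq> D \<subseteq> Y, the subspace \<open>Y\<close> can be
      replaced by the open set \<open>D\<close>; this makes U open in the whole space.\<close>
    then have "U = T \<inter> D" using UC gU D unfolding good_def by blast
    then show "openin X U" using T D by auto
  qed
  have "\<exists>C :: nat \<Rightarrow> 'a set. (\<forall>k. closedin X (C k)) \<and> (\<Union>k. C k) = U" if gU: "good U" for U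
  proof -
    let ?K = "X closure_of U"
    have "is_base (subtopology X ?K) ((\<lambda>W. W \<inter> ?K) ` B)"
      using is_base_trace[OF base] gU D unfolding good_def by blast
    moreover have "countable {V \<in> (\<lambda>W. W \<inter> ?K) ` B. x \<in> V}" for x
    proof -
      have "countable (\<Union>n. (\<lambda>W. W \<inter> ?K) ` {W \<in> G n. x \<in> W})"
        using strongly_point_finite_imp_point_finite[OF spf]
        by (intro countable_UN countableI_type countable_image) (rule countable_finite)
      then show ?thesis by (rule countable_subset[rotated]) (auto simp: G)
    qed
    ultimately have "metrizable_space (subtopology X ?K)"
      using metrizable_if_point_countable_base[OF cpt haus] closedin_closure_of by blast
    moreover have "openin (subtopology X ?K) U"
      using openU[OF gU] UC[OF gU] by (metis inf.orderE openin_subtopology_Int)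
    ultimately have "fsigma_in (subtopology X ?K) U" by (rule open_imp_fsigma_in)
    then obtain C :: "nat \<Rightarrow> 'a set" where C: "\<And>k. closedin (subtopology X ?K) (C k)" "(\<Union>k. C k) = U"
      unfolding fsigma_in_ascending by blast
    have "closedin X (C k)" for k
      by (rule closedin_trans_full[OF C(1) closedin_closure_of])
    then show ?thesis using C(2) by blast
  qed
  then obtain C :: "'a set \<Rightarrow> nat \<Rightarrow> 'a set"
    where C: "\<And>U k. good U \<Longrightarrow> closedin X (C U k)" "\<And>U. good U \<Longrightarrow> (\<Union>k. C U k) = U"
    by metis
  define P where "P n k U f \<longleftrightarrow> continuous_map X (top_of_set {0..1::real}) f \<and>
      (\<forall>x\<in>topspace X. f x \<noteq> 0 \<longrightarrow> U \<in> G n \<and> x \<in> U) \<and>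
      (good U \<and> U \<in> G n \<longrightarrow> f ` C U k \<subseteq> {1})" for n k U f
  have "\<exists>f. P n k U f" for n k U
  proof (cases "good U \<and> U \<in> G n")
    case True
    then have gU: "good U" by simp
    have "closedin X (topspace X - U)" using openU[OF gU] by auto
    moreover have "C U k \<subseteq> U" using C(2)[OF gU] by blast
    then have "disjnt (topspace X - U) (C U k)" by (auto simp: disjnt_iff)
    ultimately obtain f where "continuous_map X (top_of_set {0..1::real}) f"
      "f ` (topspace X - U) \<subseteq> {0}" "f ` C U k \<subseteq> {1}"
      by (rule Urysohn_lemma[OF norm _ C(1)[OF gU] _ zero_le_one])
    then show ?thesis using True by (intro exI[of _ f]) (auto simp: P_def)
  next
    case False
    then show ?thesis by (intro exI[of _ "\<lambda>_. 0"]) (auto simp: P_def)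
  qed
  then obtain \<phi> where P: "\<And>n k U. P n k U (\<phi> n k U)" by metis
  have \<phi>: "\<And>n k U. continuous_map X (top_of_set {0..1::real}) (\<phi> n k U)"
    "\<And>n k U x. x \<in> topspace X \<Longrightarrow> \<phi> n k U x \<noteq> 0 \<Longrightarrow> U \<in> G n \<and> x \<in> U"
    "\<And>n k U. good U \<Longrightarrow> U \<in> G n \<Longrightarrow> \<phi> n k U ` C U k \<subseteq> {1}"
    using P unfolding P_def by blast+
  show ?thesis
  proof (rule that[of \<phi>, OF \<phi>(1,2)])
    fix x y assume xy: "x \<in> D" "y \<in> topspace X" "y \<noteq> x"
    have "closedin X {y}"
      using Hausdorff_imp_t1_space[OF haus] xy by (simp add: t1_space_closedin_singleton)
    \<comment> \<open>Removing y before shrinking makes the base set found below good and free of y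
      at once.\<close>
    then have "openin X (D - {y})" by (intro openin_diff D)
    then obtain V where V: "openin X V" "x \<in> V" "X closure_of V \<subseteq> D - {y}"
      by (rule regular_space_closure_shrink[OF reg, of "D - {y}" x]) (use xy in auto)
    have "x \<in> V \<inter> Y" using V xy D by blast
    then obtain U where U: "U \<in> B" "x \<in> U" "U \<subseteq> V \<inter> Y"
      by (rule is_baseE[OF base openin_subtopology_Int[OF V(1)]])
    have "X closure_of U \<subseteq> X closure_of V" using U by (intro closure_of_mono) auto
    then have gU: "good U" and "y \<notin> X closure_of U" using U V by (auto simp: good_def)
    then have yU: "y \<notin> U" using UC by blast
    obtain n where n: "U \<in> G n" using U G by blast
    obtain k where "x \<in> C U k" using C(2)[OF gU] U by blast
    then have "\<phi> n k U x = 1" using \<phi>(3)[OF gU n] by blast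
    moreover have "\<phi> n k U y = 0" using \<phi>(2)[OF xy(2)] yU by blast
    ultimately show "\<exists>n k U. \<phi> n k U x \<noteq> \<phi> n k U y" by (metis zero_neq_one)
  qed auto
qed

section \<open>Weakly compact sets in \<open>c\<^sub>0\<close> and \<open>\<ell>\<^sup>2\<close>\<close>

lemma continuous_map_real_iff:
  fixes f :: "'a \<Rightarrow> real"
  shows "continuous_map X euclideanreal f \<longleftrightarrow>
    (\<forall>x\<in>topspace X. \<forall>e>0. \<exists>U. openin X U \<and> x \<in> U \<and> (\<forall>y\<in>U. \<bar>f x - f y\<bar> < e))"
  using Met_TC.continuous_map_to_metric[of X f] by (simp add: dist_real_def)

lemma continuous_map_real_approx:
  fixes h :: "'a \<Rightarrow> real"
  assumes approx: "\<And>e. e > 0 \<Longrightarrow>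
    \<exists>g. continuous_map X euclideanreal g \<and> (\<forall>x\<in>topspace X. \<bar>g x - h x\<bar> \<le> e)"
  shows "continuous_map X euclideanreal h"
  unfolding continuous_map_real_iff
proof (intro ballI allI impI)
  fix x and e :: real assume x: "x \<in> topspace X" and e: "e > 0"
  then have e4: "e/4 > 0" by simp
  obtain g where g: "continuous_map X euclideanreal g"
    "\<forall>x\<in>topspace X. \<bar>g x - h x\<bar> \<le> e/4"
    using approx[OF e4] by blast
  obtain U where U: "openin X U" "x \<in> U" "\<forall>y\<in>U. \<bar>g x - g y\<bar> < e/4"
    using g(1) x e4 unfolding continuous_map_real_iff by meson
  have "\<bar>h x - h y\<bar> < e" if "y \<in> U" for y
  proof -
    have "y \<in> topspace X" using that U(1) openin_subset by blast
    then have "\<bar>g y - h y\<bar> \<le> e/4" "\<bar>g x - h x\<bar> \<le> e/4" "\<bar>g x - g y\<bar> < e/4"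
      using g(2) x U(3) that by auto
    then show ?thesis by linarith
  qed
  then show "\<exists>U. openin X U \<and> x \<in> U \<and> (\<forall>y\<in>U. \<bar>h x - h y\<bar> < e)"
    using U by blast
qed

section \<open>Families with vanishing tails as a Banach space\<close>

abbreviation fun_add :: "('i \<Rightarrow> real) \<Rightarrow> ('i \<Rightarrow> real) \<Rightarrow> 'i \<Rightarrow> real" where
  "fun_add u v \<equiv> \<lambda>i. u i + v i"

abbreviation fun_smul :: "real \<Rightarrow> ('i \<Rightarrow> real) \<Rightarrow> 'i \<Rightarrow> real" where
  "fun_smul a v \<equiv> \<lambda>i. a * v i"

definition restr :: "'i set \<Rightarrow> ('i \<Rightarrow> real) \<Rightarrow> 'i \<Rightarrow> real" where
  "restr S v i = (if i \<in> S then v i else 0)"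

text \<open>
  The instances are the maximum norm on \<open>T\<close>, for which the space \<open>V\<close> below is \<open>c\<^sub>0\<close>, and the
  Euclidean norm on \<open>T\<close>, for which it is \<open>\<ell>\<^sup>2\<close>. The quadratic term in \<open>q_disjoint\<close> is what forces
  bounded functionals to be small off some finite set; the assumption fails for \<open>\<ell>\<^sup>1\<close>.
\<close>

locale finite_seminorms =
  fixes q :: "'i set \<Rightarrow> ('i \<Rightarrow> real) \<Rightarrow> real"
  assumes q_scale: "finite T \<Longrightarrow> q T (fun_smul a v) = \<bar>a\<bar> * q T v"
    and q_triangle: "finite T \<Longrightarrow> q T (fun_add u v) \<le> q T u + q T v"
    and q_coord: "finite T \<Longrightarrow> i \<in> T \<Longrightarrow> \<bar>v i\<bar> \<le> q T v"
    and q_mono: "finite T \<Longrightarrow> S \<subseteq> T \<Longrightarrow> q S v \<le> q T v"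
    and q_le_sum: "finite T \<Longrightarrow> q T v \<le> (\<Sum>i\<in>T. \<bar>v i\<bar>)"
    and q_union: "finite S \<Longrightarrow> finite T \<Longrightarrow> q (S \<union> T) v \<le> q S v + q T v"
    and q_disjoint: "finite S \<Longrightarrow> finite T \<Longrightarrow> S \<inter> T = {} \<Longrightarrow> q S v \<le> 1 \<Longrightarrow> q T v \<le> t \<Longrightarrow>
           q (S \<union> T) v \<le> 1 + t\<^sup>2"
begin

lemma q_nonneg: "finite T \<Longrightarrow> 0 \<le> q T v"
  using q_triangle[of T v "fun_smul (-1) v"] q_scale[of T "-1" v] q_scale[of T 0 v] by simp

text \<open>Locality of \<open>q T\<close> comes from \<open>q_le_sum\<close>, applied to the
  difference u - v, which vanishes on \<open>T\<close>.\<close>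

lemma q_cong_le: "finite T \<Longrightarrow> (\<And>i. i \<in> T \<Longrightarrow> u i = v i) \<Longrightarrow> q T u \<le> q T v"
  using q_triangle[of T v "\<lambda>i. u i - v i"] q_le_sum[of T "\<lambda>i. u i - v i"] by simp

lemma q_cong: "finite T \<Longrightarrow> (\<And>i. i \<in> T \<Longrightarrow> u i = v i) \<Longrightarrow> q T u = q T v"
  by (intro antisym q_cong_le) auto

lemma q_zero: "finite T \<Longrightarrow> (\<And>i. i \<in> T \<Longrightarrow> v i = 0) \<Longrightarrow> q T v = 0"
  using q_le_sum[of T v] q_nonneg[of T v] by simp

text \<open>The tail condition is a Cauchy criterion over finite sets: it means vanishing at
  infinity for the maximum and square summability for the Euclidean norm.\<close>

definition V :: "('i \<Rightarrow> real) set" where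
  "V = {v. \<forall>e>0. \<exists>S. finite S \<and> (\<forall>T. finite T \<and> T \<inter> S = {} \<longrightarrow> q T v \<le> e)}"

definition nrm :: "('i \<Rightarrow> real) \<Rightarrow> real" where
  "nrm v = (SUP T\<in>Collect finite. q T v)"

lemma V_I:
  assumes "\<And>e. e > 0 \<Longrightarrow> \<exists>S. finite S \<and> (\<forall>T. finite T \<and> T \<inter> S = {} \<longrightarrow> q T v \<le> e)"
  shows "v \<in> V"
  using assms unfolding V_def by blast

lemma V_D:
  "v \<in> V \<Longrightarrow> e > 0 \<Longrightarrow> \<exists>S. finite S \<and> (\<forall>T. finite T \<and> T \<inter> S = {} \<longrightarrow> q T v \<le> e)"
  by (simp add: V_def)

lemma q_bdd:
  assumes "v \<in> V"
  shows "bdd_above ((\<lambda>T. q T v) ` Collect finite)"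
proof -
  obtain S where S: "finite S" "\<forall>T. finite T \<and> T \<inter> S = {} \<longrightarrow> q T v \<le> 1"
    using V_D[OF assms zero_less_one] by blast
  have "q T v \<le> q S v + 1" if "finite T" for T
  proof -
    have "q T v \<le> q (S \<union> (T - S)) v" using that S by (intro q_mono) auto
    also have "\<dots> \<le> q S v + q (T - S) v" using that S by (intro q_union) auto
    also have "q (T - S) v \<le> 1" using that S(2) by blast
    finally show ?thesis by simp
  qed
  then show ?thesis by (intro bdd_aboveI2) auto
qed

lemma q_le_nrm: "v \<in> V \<Longrightarrow> finite T \<Longrightarrow> q T v \<le> nrm v"
  unfolding nrm_def by (rule cSUP_upper) (auto simp: q_bdd)

lemma nrm_le: "(\<And>T. finite T \<Longrightarrow> q T v \<le> c) \<Longrightarrow> nrm v \<le> c"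
  unfolding nrm_def by (rule cSUP_least) auto

lemma coord_le_nrm: "v \<in> V \<Longrightarrow> \<bar>v i\<bar> \<le> nrm v"
  using q_le_nrm[of v "{i}"] q_coord[of "{i}" i v] by simp

lemma nrm_nonneg: "v \<in> V \<Longrightarrow> 0 \<le> nrm v"
  using q_le_nrm[of v "{}"] q_nonneg[of "{}" v] by simp

lemma finite_support_in_V:
  assumes "finite S" "\<And>i. i \<notin> S \<Longrightarrow> v i = 0"
  shows "v \<in> V"
proof (rule V_I)
  fix e :: real assume "e > 0"
  moreover have "q T v = 0" if "finite T" "T \<inter> S = {}" for T
    using that assms by (intro q_zero) auto
  ultimately show "\<exists>S. finite S \<and> (\<forall>T. finite T \<and> T \<inter> S = {} \<longrightarrow> q T v \<le> e)"
    using assms by (intro exI[of _ S]) auto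
qed

lemma zero_in_V [simp]: "(\<lambda>i. 0) \<in> V"
  by (rule finite_support_in_V[of "{}"]) auto

lemma add_in_V:
  assumes "u \<in> V" "v \<in> V"
  shows "fun_add u v \<in> V"
proof (rule V_I)
  fix e :: real assume e: "e > 0"
  obtain S where S: "finite S" "\<forall>T. finite T \<and> T \<inter> S = {} \<longrightarrow> q T u \<le> e/2"
    using V_D[OF assms(1) half_gt_zero[OF e]] by blast
  obtain S' where S': "finite S'" "\<forall>T. finite T \<and> T \<inter> S' = {} \<longrightarrow> q T v \<le> e/2"
    using V_D[OF assms(2) half_gt_zero[OF e]] by blast
  have "q T (fun_add u v) \<le> e" if "finite T" "T \<inter> (S \<union> S') = {}" for T
  proof -
    have "q T u \<le> e/2" "q T v \<le> e/2" using S(2) S'(2) that by blast+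
    then show ?thesis using q_triangle[OF that(1), of u v] by linarith
  qed
  then show "\<exists>S. finite S \<and> (\<forall>T. finite T \<and> T \<inter> S = {} \<longrightarrow> q T (fun_add u v) \<le> e)"
    using S(1) S'(1) by (intro exI[of _ "S \<union> S'"]) auto
qed

lemma smul_in_V:
  assumes "v \<in> V"
  shows "fun_smul a v \<in> V"
proof (rule V_I)
  fix e :: real assume e: "e > 0"
  then have e': "e / (\<bar>a\<bar> + 1) > 0" by (simp add: add_pos_nonneg)
  obtain S where S: "finite S" "\<forall>T. finite T \<and> T \<inter> S = {} \<longrightarrow> q T v \<le> e / (\<bar>a\<bar> + 1)"
    using V_D[OF assms e'] by blast
  have "q T (fun_smul a v) \<le> e" if "finite T" "T \<inter> S = {}" for T
  proof -
    have "q T (fun_smul a v) \<le> \<bar>a\<bar> * (e / (\<bar>a\<bar> + 1))"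
      unfolding q_scale[OF that(1)] using S(2) that by (intro mult_left_mono) auto
    also have "\<dots> \<le> e" using e by (simp add: field_simps)
    finally show ?thesis .
  qed
  then show "\<exists>S. finite S \<and> (\<forall>T. finite T \<and> T \<inter> S = {} \<longrightarrow> q T (fun_smul a v) \<le> e)"
    using S(1) by blast
qed

lemma diff_in_V: "u \<in> V \<Longrightarrow> v \<in> V \<Longrightarrow> (\<lambda>i. u i - v i) \<in> V"
  using add_in_V[OF _ smul_in_V[of v "-1"], of u] by simp

lemma nrm_triangle:
  assumes "u \<in> V" "v \<in> V"
  shows "nrm (fun_add u v) \<le> nrm u + nrm v"
proof (rule nrm_le)
  fix T :: "'i set" assume T: "finite T"
  show "q T (fun_add u v) \<le> nrm u + nrm v"
    using q_triangle[OF T, of u v] q_le_nrm[OF assms(1) T] q_le_nrm[OF assms(2) T] by linarith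
qed

lemma nrm_smul_le:
  assumes "v \<in> V"
  shows "nrm (fun_smul a v) \<le> \<bar>a\<bar> * nrm v"
  by (rule nrm_le) (simp add: q_scale q_le_nrm[OF assms] mult_left_mono)

lemma nrm_smul:
  assumes "v \<in> V"
  shows "nrm (fun_smul a v) = \<bar>a\<bar> * nrm v"
proof (cases "a = 0")
  case True
  then show ?thesis
    using nrm_smul_le[OF assms, of a] nrm_nonneg[OF smul_in_V[OF assms, of a]] by simp
next
  case False
  have "nrm v \<le> \<bar>1/a\<bar> * nrm (fun_smul a v)"
    using nrm_smul_le[OF smul_in_V[OF assms, of a], of "1/a"] False by simp
  then have "\<bar>a\<bar> * nrm v \<le> nrm (fun_smul a v)" using False by (simp add: field_simps abs_divide)
  then show ?thesis using nrm_smul_le[OF assms, of a] by simp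
qed

lemma nrm_eq_0_iff:
  assumes "v \<in> V"
  shows "nrm v = 0 \<longleftrightarrow> v = (\<lambda>i. 0)"
proof
  assume "nrm v = 0"
  then show "v = (\<lambda>i. 0)" using coord_le_nrm[OF assms] by (auto simp: fun_eq_iff)
next
  assume "v = (\<lambda>i. 0)"
  then show "nrm v = 0" using nrm_smul[OF assms, of 0] by simp
qed

text \<open>Coordinates converge, and the limit in m is taken with \<open>T\<close> fixed, where
  \<open>q_le_sum\<close> turns coordinatewise convergence into convergence of \<open>q T\<close>.
  The resulting bound is independent of \<open>T\<close>, so it passes to the norm and to the tails
  of the limit.\<close>

lemma complete:
  assumes sV: "\<And>n. s n \<in> V"
    and cauchy: "\<And>e. e > 0 \<Longrightarrow> \<exists>N. \<forall>m\<ge>N. \<forall>n\<ge>N. nrm (\<lambda>i. s m i - s n i) < e"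
  shows "\<exists>l\<in>V. (\<lambda>n. nrm (\<lambda>i. s n i - l i)) \<longlonglongrightarrow> 0"
proof -
  have dV: "(\<lambda>i. s m i - s n i) \<in> V" for m n by (intro diff_in_V sV)
  have "Cauchy (\<lambda>n. s n i)" for i
  proof (rule CauchyI)
    fix e :: real assume "e > 0"
    then obtain N where N: "\<And>m n. m \<ge> N \<Longrightarrow> n \<ge> N \<Longrightarrow> nrm (\<lambda>i. s m i - s n i) < e"
      using cauchy by blast
    have "norm (s m i - s n i) < e" if "m \<ge> N" "n \<ge> N" for m n
      using coord_le_nrm[OF dV[of m n], of i] N[OF that] by simp
    then show "\<exists>M. \<forall>m\<ge>M. \<forall>n\<ge>M. norm (s m i - s n i) < e" by blast
  qed
  then have "\<forall>i. \<exists>l. (\<lambda>n. s n i) \<longlonglongrightarrow> l" using Cauchy_convergent convergent_def by metis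
  then obtain l where l: "\<And>i. (\<lambda>n. s n i) \<longlonglongrightarrow> l i" by metis
  have ev: "\<exists>N. \<forall>n\<ge>N. \<forall>T. finite T \<longrightarrow> q T (\<lambda>i. s n i - l i) \<le> e" if e: "e > 0" for e
  proof -
    obtain N where N: "\<And>m n. m \<ge> N \<Longrightarrow> n \<ge> N \<Longrightarrow> nrm (\<lambda>i. s m i - s n i) < e"
      using cauchy e by blast
    have "q T (\<lambda>i. s n i - l i) \<le> e" if n: "n \<ge> N" and T: "finite T" for n T
    proof -
      have "(\<lambda>m. e + (\<Sum>i\<in>T. \<bar>s m i - l i\<bar>)) \<longlonglongrightarrow> e + (\<Sum>i\<in>T. \<bar>l i - l i\<bar>)"
        by (intro tendsto_intros l)
      moreover have "q T (\<lambda>i. s n i - l i) \<le> e + (\<Sum>i\<in>T. \<bar>s m i - l i\<bar>)" if m: "m \<ge> N" for m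
      proof -
        have "q T (\<lambda>i. s n i - l i) \<le> q T (\<lambda>i. s n i - s m i) + q T (\<lambda>i. s m i - l i)"
          using q_triangle[OF T, of "\<lambda>i. s n i - s m i" "\<lambda>i. s m i - l i"] by simp
        then show ?thesis
          using q_le_sum[OF T, of "\<lambda>i. s m i - l i"] q_le_nrm[OF dV[of n m] T] N[OF n m] by linarith
      qed
      ultimately have "q T (\<lambda>i. s n i - l i) \<le> e + (\<Sum>i\<in>T. \<bar>l i - l i\<bar>)"
        by (intro tendsto_lowerbound[where F = sequentially]) (auto simp: eventually_sequentially)
      then show ?thesis by simp
    qed
    then show ?thesis by blast
  qed
  have "l \<in> V"
  proof (rule V_I)
    fix e :: real assume e: "e > 0"
    obtain n where n: "\<And>T. finite T \<Longrightarrow> q T (\<lambda>i. s n i - l i) \<le> e/2"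
      using ev[OF half_gt_zero[OF e]] by blast
    obtain S where S: "finite S" "\<forall>T. finite T \<and> T \<inter> S = {} \<longrightarrow> q T (s n) \<le> e/2"
      using V_D[OF sV half_gt_zero[OF e]] by blast
    have "q T l \<le> e" if T: "finite T" "T \<inter> S = {}" for T
    proof -
      have "q T l \<le> q T (s n) + q T (fun_smul (-1) (\<lambda>i. s n i - l i))"
        using q_triangle[OF T(1), of "s n" "fun_smul (-1) (\<lambda>i. s n i - l i)"] by simp
      also have "q T (fun_smul (-1) (\<lambda>i. s n i - l i)) = q T (\<lambda>i. s n i - l i)"
        by (subst q_scale[OF T(1)]) simp
      finally show ?thesis using n[OF T(1)] S(2)[rule_format, OF conjI[OF T]] by linarith
    qed
    then show "\<exists>S. finite S \<and> (\<forall>T. finite T \<and> T \<inter> S = {} \<longrightarrow> q T l \<le> e)"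
      using S(1) by blast
  qed
  moreover have "(\<lambda>n. nrm (\<lambda>i. s n i - l i)) \<longlonglongrightarrow> 0"
  proof (rule LIMSEQ_I)
    fix e :: real assume e: "e > 0"
    obtain N where N: "\<And>n T. n \<ge> N \<Longrightarrow> finite T \<Longrightarrow> q T (\<lambda>i. s n i - l i) \<le> e/2"
      using ev[OF half_gt_zero[OF e]] by blast
    have "norm (nrm (\<lambda>i. s n i - l i) - 0) < e" if "n \<ge> N" for n
      using nrm_le[OF N[OF that]] nrm_nonneg[OF diff_in_V[OF sV \<open>l \<in> V\<close>, of n]] e by simp
    then show "\<exists>N. \<forall>n\<ge>N. norm (nrm (\<lambda>i. s n i - l i) - 0) < e" by blast
  qed
  ultimately show ?thesis by blast
qed

lemma real_vector_space: "real_vector_space_on V fun_add fun_smul (\<lambda>i. 0)"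
  unfolding real_vector_space_on_def
  by (auto simp: add_in_V smul_in_V algebra_simps)

lemma banach: "banach_space_on V fun_add fun_smul (\<lambda>i. 0) nrm"
  unfolding banach_space_on_def
  using complete
  by (auto simp: real_vector_space nrm_nonneg nrm_eq_0_iff nrm_smul nrm_triangle)

lemma q_restr_le:
  assumes "finite T"
  shows "q T (restr S v) \<le> q (T \<inter> S) v"
proof -
  have "q T (restr S v) \<le> q (T \<inter> S) (restr S v) + q (T - S) (restr S v)"
    using q_union[of "T \<inter> S" "T - S" "restr S v"] assms by (simp add: Int_Diff_Un)
  moreover have "q (T \<inter> S) (restr S v) = q (T \<inter> S) v"
    using assms by (intro q_cong) (auto simp: restr_def)
  moreover have "q (T - S) (restr S v) = 0"
    using assms by (intro q_zero) (auto simp: restr_def)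
  ultimately show ?thesis by simp
qed

lemma restr_in_V: "v \<in> V \<Longrightarrow> restr S v \<in> V"
proof (rule V_I)
  fix e :: real assume v: "v \<in> V" and e: "e > 0"
  obtain R where R: "finite R" "\<forall>T. finite T \<and> T \<inter> R = {} \<longrightarrow> q T v \<le> e"
    using V_D[OF v e] by blast
  have "q T (restr S v) \<le> e" if "finite T" "T \<inter> R = {}" for T
    using q_restr_le[OF that(1), of S v] q_mono[OF that(1), of "T \<inter> S" v]
      R(2)[rule_format, OF conjI[OF that]] by simp
  then show "\<exists>S'. finite S' \<and> (\<forall>T. finite T \<and> T \<inter> S' = {} \<longrightarrow> q T (restr S v) \<le> e)"
    using R(1) by blast
qed

lemma nrm_restr_le: "v \<in> V \<Longrightarrow> nrm (restr S v) \<le> nrm v"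
  by (rule nrm_le) (meson Int_lower1 finite_Int order_trans q_le_nrm q_restr_le)

section \<open>Bounded functionals and the weak topology\<close>

abbreviation "dual \<equiv> dual_space_on V fun_add fun_smul nrm"

lemma dual_add: "f \<in> dual \<Longrightarrow> u \<in> V \<Longrightarrow> v \<in> V \<Longrightarrow> f (fun_add u v) = f u + f v"
  and dual_smul: "f \<in> dual \<Longrightarrow> v \<in> V \<Longrightarrow> f (fun_smul a v) = a * f v"
  by (auto simp: dual_space_on_def)

lemma dual_bound:
  assumes "f \<in> dual"
  shows "\<exists>C\<ge>0. \<forall>v\<in>V. \<bar>f v\<bar> \<le> C * nrm v"
proof -
  obtain C where C: "\<forall>v\<in>V. \<bar>f v\<bar> \<le> C * nrm v"
    using assms by (auto simp: dual_space_on_def)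
  have "\<bar>f v\<bar> \<le> \<bar>C\<bar> * nrm v" if "v \<in> V" for v
    using C that nrm_nonneg[OF that] by (meson abs_ge_self mult_right_mono order_trans)
  then show ?thesis by (intro exI[of _ "\<bar>C\<bar>"]) simp
qed

text \<open>
  If \<open>u\<close> almost attains the norm of \<open>f\<close> and \<open>w\<close> lives off the support of \<open>u\<close>, then
  \<open>u + t w\<close> has norm at most \<open>1 + t\<^sup>2\<close>, so \<open>t f w\<close> is of order \<open>t\<^sup>2\<close>.
\<close>

lemma dual_small_off_finite:
  assumes f: "f \<in> dual" and e: "e > 0"
  shows "\<exists>S. finite S \<and> (\<forall>w\<in>V. nrm w \<le> 1 \<longrightarrow> (\<forall>i\<in>S. w i = 0) \<longrightarrow> \<bar>f w\<bar> \<le> e)"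
proof -
  obtain C where C: "C \<ge> 0" "\<forall>v\<in>V. \<bar>f v\<bar> \<le> C * nrm v"
    using dual_bound[OF f] by blast
  define U where "U = {v \<in> V. nrm v \<le> 1}"
  define M where "M = (SUP v\<in>U. f v)"
  have CU: "\<bar>f v\<bar> \<le> C" if "v \<in> U" for v
    using that C unfolding U_def by (auto intro: order_trans mult_left_le)
  have zU: "(\<lambda>i. 0) \<in> U" using nrm_eq_0_iff[of "\<lambda>i. 0"] by (simp add: U_def)
  have bdd: "bdd_above (f ` U)" using CU by (intro bdd_aboveI2[of _ _ C]) (meson abs_le_D1)
  have fM: "f v \<le> M" if "v \<in> U" for v unfolding M_def using that bdd by (rule cSUP_upper)
  have M: "M \<ge> 0" using fM[OF zU] dual_smul[OF f zero_in_V, of 0] by simp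
  \<comment> \<open>The inequalities below combine to
    \<open>M - t\<^sup>2 + t * f w \<le> M * (1 + t\<^sup>2)\<close>, that is
    \<open>f w \<le> t * (M + 1)\<close>, and this bound is to be \<open>e\<close>.\<close>
  define t where "t = e / (M + 1)"
  have t: "t > 0" using e M by (simp add: t_def)
  \<comment> \<open>Half of the admissible loss \<open>t\<^sup>2\<close> is spent on almost
    attaining the supremum, the other half on truncating u; hence the factor 2 in the tail bound,
    where \<open>C + 1\<close> keeps the denominator positive.\<close>
  have "M - t\<^sup>2/2 < M" using t by simp
  then obtain u where u: "u \<in> U" "f u > M - t\<^sup>2/2"
    unfolding M_def less_cSUP_iff[OF ex_in_conv[THEN iffD1, OF exI, OF zU] bdd] by blast
  then have uV: "u \<in> V" "nrm u \<le> 1" by (auto simp: U_def)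
  have d: "t\<^sup>2 / (2 * (C + 1)) > 0" using t C by simp
  obtain S where S: "finite S" "\<forall>T. finite T \<and> T \<inter> S = {} \<longrightarrow> q T u \<le> t\<^sup>2 / (2 * (C + 1))"
    using V_D[OF uV(1) d] by blast
  \<comment> \<open>Truncation makes the support finite, so S itself can be the exceptional set: a w
    vanishing on S has support disjoint from that of \<open>u'\<close>.\<close>
  define u' where "u' = restr S u"
  have u'V: "u' \<in> V" "nrm u' \<le> 1"
    using restr_in_V[OF uV(1)] nrm_restr_le[OF uV(1), of S] uV(2) by (auto simp: u'_def)
  have tail: "(\<lambda>i. u i - u' i) \<in> V" by (intro diff_in_V uV u'V)
  have "nrm (\<lambda>i. u i - u' i) \<le> t\<^sup>2 / (2 * (C + 1))"
  proof (rule nrm_le)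
    fix T :: "'i set" assume T: "finite T"
    have "(\<lambda>i. u i - u' i) = restr (-S) u" by (auto simp: u'_def restr_def)
    then have "q T (\<lambda>i. u i - u' i) \<le> q (T \<inter> -S) u" using q_restr_le[OF T] by simp
    also have "\<dots> \<le> t\<^sup>2 / (2 * (C + 1))" using T S(2) by blast
    finally show "q T (\<lambda>i. u i - u' i) \<le> t\<^sup>2 / (2 * (C + 1))" .
  qed
  then have "\<bar>f (\<lambda>i. u i - u' i)\<bar> \<le> C * (t\<^sup>2 / (2 * (C + 1)))"
    using C tail by (meson mult_left_mono order_trans)
  also have "\<dots> \<le> t\<^sup>2 / 2" using C(1) by (simp add: field_simps)
  finally have "f u' \<ge> f u - t\<^sup>2/2" using dual_add[OF f u'V(1) tail] by simp
  then have fu': "f u' \<ge> M - t\<^sup>2" using u by linarith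
  have main: "f w \<le> e" if w: "w \<in> V" "nrm w \<le> 1" "\<And>i. i \<in> S \<Longrightarrow> w i = 0" for w
  proof -
    define x where "x = fun_add u' (fun_smul t w)"
    have xV: "x \<in> V" unfolding x_def by (intro add_in_V smul_in_V u'V w)
    have nx: "nrm x \<le> 1 + t\<^sup>2"
    proof (rule nrm_le)
      fix T :: "'i set" assume T: "finite T"
      have "q (T \<inter> S) x = q (T \<inter> S) u'" using T w(3) by (intro q_cong) (auto simp: x_def)
      also have "\<dots> \<le> 1" using q_le_nrm[OF u'V(1), of "T \<inter> S"] u'V(2) T by simp
      finally have 1: "q (T \<inter> S) x \<le> 1" .
      have "q (T - S) x = q (T - S) (fun_smul t w)"
        using T by (intro q_cong) (auto simp: x_def u'_def restr_def)
      also have "\<dots> = t * q (T - S) w" using T t by (simp add: q_scale)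
      also have "\<dots> \<le> t" using q_le_nrm[OF w(1), of "T - S"] w(2) T t by (simp add: mult_left_le)
      finally have 2: "q (T - S) x \<le> t" .
      have "q T x = q ((T \<inter> S) \<union> (T - S)) x" by (simp add: Int_Diff_Un)
      also have "\<dots> \<le> 1 + t\<^sup>2" using T by (intro q_disjoint 1 2) auto
      finally show "q T x \<le> 1 + t\<^sup>2" .
    qed
    \<comment> \<open>Scaling by \<open>c\<close> returns x to the unit ball, where f is at most
      \<open>M\<close>.\<close>
    define c where "c = 1 / (1 + t\<^sup>2)"
    have pos: "1 + t\<^sup>2 > 0" by (simp add: add_pos_nonneg)
    have "nrm (fun_smul c x) \<le> 1"
      unfolding nrm_smul[OF xV] using nx pos by (simp add: c_def abs_of_pos)
    then have "f (fun_smul c x) \<le> M" using smul_in_V[OF xV] by (intro fM) (simp add: U_def)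
    then have "f x \<le> M * (1 + t\<^sup>2)"
      unfolding dual_smul[OF f xV] using pos by (simp add: c_def field_simps)
    moreover have "f x = f u' + t * f w"
      unfolding x_def using dual_add[OF f u'V(1) smul_in_V[OF w(1)]] dual_smul[OF f w(1)] by simp
    ultimately have "t * f w \<le> t * (t * (M + 1))" using fu' by (simp add: algebra_simps power2_eq_square)
    then have "f w \<le> t * (M + 1)" using t by simp
    then show ?thesis using M by (simp add: t_def)
  qed
  have "\<bar>f w\<bar> \<le> e" if w: "w \<in> V" "nrm w \<le> 1" "\<And>i. i \<in> S \<Longrightarrow> w i = 0" for w
  proof -
    have "f (fun_smul (-1) w) \<le> e"
      using w smul_in_V[OF w(1), of "-1"] nrm_smul[OF w(1), of "-1"] by (intro main) auto
    then have "- f w \<le> e" unfolding dual_smul[OF f w(1)] by simp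
    then show ?thesis using main[OF w] by simp
  qed
  then show ?thesis using S(1) by blast
qed

lemma dual_restr_finite:
  assumes f: "f \<in> dual" and S: "finite S"
  shows "f (restr S v) = (\<Sum>i\<in>S. v i * f (restr {i} (\<lambda>_. 1)))"
  using S
proof (induction S rule: finite_induct)
  case empty
  have "restr {} v = fun_smul 0 (\<lambda>i. 0)" by (auto simp: restr_def)
  then show ?case using dual_smul[OF f zero_in_V, of 0] by simp
next
  case (insert i S)
  have 1: "restr {i} (\<lambda>_. 1) \<in> V" by (rule finite_support_in_V[of "{i}"]) (auto simp: restr_def)
  have 2: "restr S v \<in> V" using insert by (intro finite_support_in_V[of S]) (auto simp: restr_def)
  have "restr (insert i S) v = fun_add (fun_smul (v i) (restr {i} (\<lambda>_. 1))) (restr S v)"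
    using insert by (auto simp: restr_def)
  then show ?case
    using insert dual_add[OF f smul_in_V[OF 1] 2] dual_smul[OF f 1] by simp
qed

text \<open>The composition is a uniform limit of finite linear combinations of coordinates, because
  f is small on bounded tails off a finite set.\<close>

lemma continuous_map_dual_comp:
  assumes f: "f \<in> dual" and \<Phi>V: "\<And>x. x \<in> topspace X \<Longrightarrow> \<Phi> x \<in> V"
    and bound: "\<And>x. x \<in> topspace X \<Longrightarrow> nrm (\<Phi> x) \<le> R" and R: "R > 0"
    and cont: "\<And>i. continuous_map X euclideanreal (\<lambda>x. \<Phi> x i)"
  shows "continuous_map X euclideanreal (\<lambda>x. f (\<Phi> x))"
proof (rule continuous_map_real_approx)
  fix e :: real assume e: "e > 0"
  obtain S where S: "finite S"
    "\<forall>w\<in>V. nrm w \<le> 1 \<longrightarrow> (\<forall>i\<in>S. w i = 0) \<longrightarrow> \<bar>f w\<bar> \<le> e / R"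
    using dual_small_off_finite[OF f divide_pos_pos[OF e R]] by blast
  have "continuous_map X euclideanreal (\<lambda>x. f (restr S (\<Phi> x)))"
    unfolding dual_restr_finite[OF f S(1)]
    by (intro continuous_map_sum S continuous_map_real_mult_right cont)
  moreover have "\<bar>f (restr S (\<Phi> x)) - f (\<Phi> x)\<bar> \<le> e" if x: "x \<in> topspace X" for x
  proof -
    have r: "restr T (\<Phi> x) \<in> V" for T using restr_in_V[OF \<Phi>V[OF x]] .
    \<comment> \<open>Dividing by \<open>R\<close> puts the tail into the unit ball; this is why the
      precision was \<open>e / R\<close>.\<close>
    define w where "w = fun_smul (1/R) (restr (-S) (\<Phi> x))"
    have "w \<in> V" unfolding w_def by (intro smul_in_V r)
    moreover have "nrm w \<le> 1"
      using nrm_smul[OF r, of "1/R" "-S"] nrm_restr_le[OF \<Phi>V[OF x], of "-S"] bound[OF x] R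
      by (simp add: w_def)
    ultimately have "\<bar>f w\<bar> \<le> e / R" by (intro S(2)[rule_format]) (auto simp: w_def restr_def)
    moreover have "f w = f (restr (-S) (\<Phi> x)) / R"
      unfolding w_def dual_smul[OF f r] by simp
    ultimately have "\<bar>f (restr (-S) (\<Phi> x))\<bar> \<le> e" using R by (simp add: divide_le_cancel)
    moreover have "fun_add (restr S (\<Phi> x)) (restr (-S) (\<Phi> x)) = \<Phi> x" by (auto simp: restr_def)
    ultimately show ?thesis using dual_add[OF f r r, of S "-S"] by simp
  qed
  ultimately show "\<exists>g. continuous_map X euclideanreal g \<and> (\<forall>x\<in>topspace X. \<bar>g x - f (\<Phi> x)\<bar> \<le> e)"
    by blast
qed

abbreviation "weak \<equiv> weak_topology_on V fun_add fun_smul nrm"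

lemma topspace_weak: "topspace weak = V"
  by (auto simp: weak_topology_on_def)

lemma coord_in_dual: "(\<lambda>v. v i) \<in> dual"
  using coord_le_nrm by (auto simp: dual_space_on_def intro!: exI[of _ 1])

lemma openin_weak: "f \<in> dual \<Longrightarrow> open U \<Longrightarrow> openin weak {v \<in> V. f v \<in> U}"
  unfolding weak_topology_on_def by (intro topology_generated_by_Basis) blast

lemma Hausdorff_weak: "Hausdorff_space weak"
  unfolding Hausdorff_space_def topspace_weak
proof (intro allI impI)
  fix u v assume uv: "u \<in> V \<and> v \<in> V \<and> u \<noteq> v"
  then obtain i where "u i \<noteq> v i" by auto
  then obtain A B where AB: "open A" "open B" "u i \<in> A" "v i \<in> B" "A \<inter> B = {}"
    using hausdorff by metis
  show "\<exists>A B. openin weak A \<and> openin weak B \<and> u \<in> A \<and> v \<in> B \<and> disjnt A B"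
    using AB uv openin_weak[OF coord_in_dual AB(1), of i] openin_weak[OF coord_in_dual AB(2), of i]
    by (intro exI[of _ "{w \<in> V. w i \<in> A}"] exI[of _ "{w \<in> V. w i \<in> B}"]) (auto simp: disjnt_iff)
qed

lemma weakly_compact_image:
  assumes cpt: "compact_space X" and \<Phi>V: "\<And>x. x \<in> topspace X \<Longrightarrow> \<Phi> x \<in> V"
    and bound: "\<And>x. x \<in> topspace X \<Longrightarrow> nrm (\<Phi> x) \<le> R"
    and cont: "\<And>i. continuous_map X euclideanreal (\<lambda>x. \<Phi> x i)"
    and inj: "inj_on \<Phi> (topspace X)"
  shows "\<exists>K\<subseteq>V. compactin weak K \<and> X homeomorphic_space subtopology weak K"
proof -
  have cw: "continuous_map X weak \<Phi>"
    unfolding weak_topology_on_def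
  proof (rule continuous_on_generated_topo)
    fix U assume "U \<in> insert V {{v \<in> V. f v \<in> A} |f A. f \<in> dual \<and> open A}"
    then consider "U = V" | f A where "f \<in> dual" "open A" "U = {v \<in> V. f v \<in> A}" by blast
    then show "openin X (\<Phi> -` U \<inter> topspace X)"
    proof cases
      case 1
      then have "\<Phi> -` U \<inter> topspace X = topspace X" using \<Phi>V by auto
      then show ?thesis by simp
    next
      case 2
      \<comment> \<open>\<open>max R 1\<close> supplies the positive bound required here, as
        \<open>R\<close> itself is not assumed positive.\<close>
      have "continuous_map X euclideanreal (\<lambda>x. f (\<Phi> x))"
        using bound by (intro continuous_map_dual_comp[OF 2(1) \<Phi>V, where R = "max R 1"] cont) fastforce+
      then have "openin X {x \<in> topspace X. f (\<Phi> x) \<in> A}"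
        using 2(2) by (simp add: openin_continuous_map_preimage)
      moreover have "\<Phi> -` U \<inter> topspace X = {x \<in> topspace X. f (\<Phi> x) \<in> A}"
        using 2(3) \<Phi>V by auto
      ultimately show ?thesis by simp
    qed
  qed (use \<Phi>V in auto)
  then have "embedding_map X weak \<Phi>"
    by (rule continuous_imp_embedding_map[OF _ cpt Hausdorff_weak inj])
  then have "X homeomorphic_space subtopology weak (\<Phi> ` topspace X)"
    by (rule embedding_map_imp_homeomorphic_space)
  moreover have "compactin weak (\<Phi> ` topspace X)"
    using cpt unfolding compact_space_def by (rule image_compactin[OF _ cw])
  moreover have "\<Phi> ` topspace X \<subseteq> V" using \<Phi>V by blast
  ultimately show ?thesis by blast
qed

end

section \<open>Families controlled level by level\<close>

context finite_seminorms
begin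

text \<open>The right-hand side is the sum of \<open>(1/2) ^ n\<close> over N \<le> n < M, collected
  by one use of \<open>q_union\<close> per level.\<close>

lemma q_geometric_le:
  assumes small: "\<And>n T. finite T \<Longrightarrow> (\<And>i. i \<in> T \<Longrightarrow> lev i = n) \<Longrightarrow> q T v \<le> (1/2) ^ n"
    and T: "finite T" "\<And>i. i \<in> T \<Longrightarrow> N \<le> lev i \<and> lev i < M" and NM: "N \<le> (M::nat)"
  shows "q T v \<le> 2 * (1/2) ^ N - 2 * (1/2) ^ M"
  using NM T
proof (induction M arbitrary: T rule: dec_induct)
  case base
  then have "T = {}" by force
  then show ?case using q_zero[of "{}" v] by simp
next
  case (step M)
  let ?A = "{i \<in> T. lev i < M}" and ?B = "{i \<in> T. lev i = M}"
  have "T = ?A \<union> ?B" using step.prems by force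
  then have "q T v \<le> q ?A v + q ?B v" using q_union[of ?A ?B v] step.prems by simp
  also have "q ?A v \<le> 2 * (1/2) ^ N - 2 * (1/2) ^ M" using step.prems by (intro step.IH) auto
  also have "q ?B v \<le> (1/2) ^ M" using step.prems by (intro small) auto
  finally show ?case by simp
qed

text \<open>Below level N only finitely many coordinates are non-zero, and the levels from N on
  contribute at most \<open>2 * (1/2) ^ N\<close>. The norm bound is the case N = 0.\<close>

lemma levels_in_V:
  fixes lev :: "'i \<Rightarrow> nat"
  assumes small: "\<And>n T. finite T \<Longrightarrow> (\<And>i. i \<in> T \<Longrightarrow> lev i = n) \<Longrightarrow> q T v \<le> (1/2) ^ n"
    and fin: "\<And>n. finite {i. lev i = n \<and> v i \<noteq> 0}"
  shows "v \<in> V" "nrm v \<le> 2"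
proof -
  have tail: "q T v \<le> 2 * (1/2) ^ N" if T: "finite T" "\<And>i. i \<in> T \<Longrightarrow> N \<le> lev i" for T N
  proof -
    \<comment> \<open>M lies strictly above every level met by \<open>T\<close>; inserting N gives N
      \<le> M also when \<open>T\<close> is empty.\<close>
    define M where "M = Max (insert N (Suc ` lev ` T))"
    have M: "N \<le> M" "\<And>i. i \<in> T \<Longrightarrow> Suc (lev i) \<le> M" using T by (auto simp: M_def intro: Max_ge)
    have "q T v \<le> 2 * (1/2) ^ N - 2 * (1/2) ^ M"
      using T M by (intro q_geometric_le[where lev = lev] small) (auto simp: Suc_le_eq)
    moreover have "(0::real) \<le> 2 * (1/2) ^ M" by simp
    ultimately show ?thesis by linarith
  qed
  show "nrm v \<le> 2" using tail[of _ 0] by (intro nrm_le) auto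
  show "v \<in> V"
  proof (rule V_I)
    fix e :: real assume e: "e > 0"
    obtain N where N: "(1/2::real) ^ N < e/2" using real_arch_pow_inv[of "e/2" "1/2"] e by auto
    define S where "S = (\<Union>n<N. {i. lev i = n \<and> v i \<noteq> 0})"
    have "finite S" using fin by (simp add: S_def)
    moreover have "q T v \<le> e" if T: "finite T" "T \<inter> S = {}" for T
    proof -
      let ?A = "{i \<in> T. lev i < N}" and ?B = "{i \<in> T. N \<le> lev i}"
      have "T = ?A \<union> ?B" by auto
      then have "q T v \<le> q ?A v + q ?B v" using q_union[of ?A ?B v] T by simp
      also have "q ?A v = 0" using T by (intro q_zero) (auto simp: S_def)
      also have "q ?B v \<le> 2 * (1/2) ^ N" using T by (intro tail) auto
      finally show ?thesis using N by simp
    qed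
    ultimately show "\<exists>S. finite S \<and> (\<forall>T. finite T \<and> T \<inter> S = {} \<longrightarrow> q T v \<le> e)" by blast
  qed
qed

lemma weakly_compact_image_levels:
  fixes lev :: "'i \<Rightarrow> nat"
  assumes cpt: "compact_space X"
    and cont: "\<And>i. continuous_map X euclideanreal (\<lambda>x. \<Phi> x i)"
    and inj: "inj_on \<Phi> (topspace X)"
    and small: "\<And>x n T. x \<in> topspace X \<Longrightarrow> finite T \<Longrightarrow> (\<And>i. i \<in> T \<Longrightarrow> lev i = n) \<Longrightarrow>
      q T (\<Phi> x) \<le> (1/2) ^ n"
    and fin: "\<And>x n. x \<in> topspace X \<Longrightarrow> finite {i. lev i = n \<and> \<Phi> x i \<noteq> 0}"
  shows "\<exists>K\<subseteq>V. compactin weak K \<and> X homeomorphic_space subtopology weak K"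
proof (rule weakly_compact_image[OF cpt _ _ cont inj])
  show "\<Phi> x \<in> V" if "x \<in> topspace X" for x
    using levels_in_V(1)[OF small fin] that by blast
  show "nrm (\<Phi> x) \<le> 2" if "x \<in> topspace X" for x
    using levels_in_V(2)[OF small fin] that by blast
qed

end

section \<open>The instances c_0 and l^2\<close>

definition max_on :: "'i set \<Rightarrow> ('i \<Rightarrow> real) \<Rightarrow> real" where
  "max_on T v = Max (insert 0 ((\<lambda>i. \<bar>v i\<bar>) ` T))"

lemma max_on_le_iff: "finite T \<Longrightarrow> max_on T v \<le> c \<longleftrightarrow> 0 \<le> c \<and> (\<forall>i\<in>T. \<bar>v i\<bar> \<le> c)"
  by (simp add: max_on_def)

lemma max_on_ge: "finite T \<Longrightarrow> i \<in> T \<Longrightarrow> \<bar>v i\<bar> \<le> max_on T v"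
  and max_on_nonneg: "finite T \<Longrightarrow> 0 \<le> max_on T v"
  using max_on_le_iff[of T v "max_on T v"] by simp_all

lemma max_on_scale_le: "finite T \<Longrightarrow> max_on T (\<lambda>i. a * v i) \<le> \<bar>a\<bar> * max_on T v"
  by (simp add: max_on_le_iff abs_mult max_on_ge max_on_nonneg mult_left_mono)

interpretation c0: finite_seminorms "max_on :: 'i set \<Rightarrow> ('i \<Rightarrow> real) \<Rightarrow> real"
proof
  fix T S :: "'i set" and u v :: "'i \<Rightarrow> real" and a t :: real and i
  assume T: "finite T"
  show "max_on T (\<lambda>i. a * v i) = \<bar>a\<bar> * max_on T v"
  proof (cases "a = 0")
    case True
    then show ?thesis
      using max_on_scale_le[OF T, of a v] max_on_nonneg[OF T, of "\<lambda>i. a * v i"] by simp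
  next
    case False
    have "max_on T v \<le> \<bar>1/a\<bar> * max_on T (\<lambda>i. a * v i)"
      using max_on_scale_le[OF T, of "1/a" "\<lambda>i. a * v i"] False by simp
    then show ?thesis
      using max_on_scale_le[OF T, of a v] False by (simp add: field_simps abs_divide)
  qed
  have "\<bar>u i + v i\<bar> \<le> max_on T u + max_on T v" if "i \<in> T" for i
    using max_on_ge[OF T that, of u] max_on_ge[OF T that, of v] by linarith
  then show "max_on T (\<lambda>i. u i + v i) \<le> max_on T u + max_on T v"
    using max_on_nonneg[OF T] by (simp add: max_on_le_iff[OF T])
  show "\<bar>v i\<bar> \<le> max_on T v" if "i \<in> T" using max_on_ge[OF T that] .
  show "max_on S v \<le> max_on T v" if "S \<subseteq> T"
    using that T max_on_ge[OF T] max_on_nonneg[OF T] finite_subset[OF that T]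
    by (auto simp: max_on_le_iff)
  show "max_on T v \<le> (\<Sum>i\<in>T. \<bar>v i\<bar>)"
    using T by (auto simp: max_on_le_iff sum_nonneg intro: member_le_sum)
next
  fix T S :: "'i set" and v :: "'i \<Rightarrow> real" and t :: real
  assume S: "finite S" and T: "finite T"
  show "max_on (S \<union> T) v \<le> max_on S v + max_on T v"
    using S T max_on_nonneg[OF S, of v] max_on_nonneg[OF T, of v]
      max_on_ge[OF S, of _ v] max_on_ge[OF T, of _ v]
    by (fastforce simp: max_on_le_iff)
  assume le: "max_on S v \<le> 1" "max_on T v \<le> t"
  \<comment> \<open>For the maximum, the value on a union is at most the larger of 1 and t, so
    \<open>q_disjoint\<close> reduces to this inequality.\<close>
  have t: "t \<le> 1 + t\<^sup>2"
    using zero_le_power2[of "t - 1/2"] by (simp add: power2_eq_square algebra_simps)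
  have "\<bar>v i\<bar> \<le> 1 + t\<^sup>2" if "i \<in> S \<union> T" for i
    using that
  proof
    assume "i \<in> S"
    then show ?thesis using max_on_ge[OF S, of i v] le(1) zero_le_power2[of t] by linarith
  next
    assume "i \<in> T"
    then show ?thesis using max_on_ge[OF T, of i v] le(2) t by linarith
  qed
  then show "max_on (S \<union> T) v \<le> 1 + t\<^sup>2"
    using S T by (simp add: max_on_le_iff)
qed

lemma L2_set_power2: "(L2_set v T)\<^sup>2 = (\<Sum>i\<in>T. (v i)\<^sup>2)"
  by (simp add: L2_set_def sum_nonneg)

interpretation l2: finite_seminorms "\<lambda>T v. L2_set v T :: real"
proof
  fix T S :: "'i set" and u v :: "'i \<Rightarrow> real" and a t :: real and i
  assume T: "finite T"
  show "L2_set (\<lambda>i. a * v i) T = \<bar>a\<bar> * L2_set v T"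
    by (simp add: L2_set_def power_mult_distrib real_sqrt_mult flip: sum_distrib_left)
  show "L2_set (\<lambda>i. u i + v i) T \<le> L2_set u T + L2_set v T" by (rule L2_set_triangle_ineq)
  show "\<bar>v i\<bar> \<le> L2_set v T" if "i \<in> T"
    using member_le_L2_set[OF T that, of "\<lambda>i. \<bar>v i\<bar>"] by (simp add: L2_set_def)
  show "L2_set v S \<le> L2_set v T" if "S \<subseteq> T"
    unfolding L2_set_def using that T by (intro real_sqrt_le_mono sum_mono2) auto
  show "L2_set v T \<le> (\<Sum>i\<in>T. \<bar>v i\<bar>)" by (rule L2_set_le_sum_abs)
next
  fix T S :: "'i set" and v :: "'i \<Rightarrow> real" and t :: real
  assume S: "finite S" and T: "finite T"
  have "(\<Sum>i\<in>S \<union> T. (v i)\<^sup>2) \<le> (\<Sum>i\<in>S. (v i)\<^sup>2) + (\<Sum>i\<in>T. (v i)\<^sup>2)"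
    using sum.union_inter[OF S T, of "\<lambda>i. (v i)\<^sup>2"] sum_nonneg[of "S \<inter> T" "\<lambda>i. (v i)\<^sup>2"] by simp
  also have "\<dots> = (L2_set v S)\<^sup>2 + (L2_set v T)\<^sup>2" by (simp add: L2_set_power2)
  also have le: "\<dots> \<le> (L2_set v S + L2_set v T)\<^sup>2" by (simp add: power2_sum)
  finally show "L2_set v (S \<union> T) \<le> L2_set v S + L2_set v T"
    unfolding L2_set_def[of v "S \<union> T"] by (intro real_le_lsqrt) (auto simp: sum_nonneg)
  assume "S \<inter> T = {}" and S1: "L2_set v S \<le> 1" and Tt: "L2_set v T \<le> t"
  \<comment> \<open>Disjointness gives Pythagoras. The resulting bound \<open>1 + t\<^sup>2\<close>
    on the square is at least 1, hence at most its own square.\<close>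
  then have "(L2_set v (S \<union> T))\<^sup>2 = (L2_set v S)\<^sup>2 + (L2_set v T)\<^sup>2"
    using S T by (simp add: L2_set_power2 sum.union_disjoint)
  also have "\<dots> \<le> 1 + t\<^sup>2"
    using S1 Tt by (intro add_mono power_mono) (auto simp: power_le_one)
  also have "\<dots> \<le> (1 + t\<^sup>2)\<^sup>2" by (rule self_le_power) auto
  finally show "L2_set v (S \<union> T) \<le> 1 + t\<^sup>2" by (rule power2_le_imp_le) simp
qed

text \<open>Finite sums of squares are bounded by the squared norm. This links the tail condition to
  the infinite sums in which the inner product is expressed.\<close>

lemma l2_summable:
  assumes "v \<in> l2.V"
  shows "(\<lambda>i. (v i)\<^sup>2) summable_on UNIV"
proof (rule nonneg_bdd_above_summable_on)
  have "(\<Sum>i\<in>T. (v i)\<^sup>2) \<le> (l2.nrm v)\<^sup>2" if "finite T" for T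
    using power_mono[OF l2.q_le_nrm[OF assms that], of 2] by (simp add: L2_set_power2)
  then show "bdd_above (sum (\<lambda>i. (v i)\<^sup>2) ` {F. F \<subseteq> UNIV \<and> finite F})"
    by (intro bdd_aboveI2) auto
qed auto

lemma l2_mult_summable:
  assumes "u \<in> l2.V" "v \<in> l2.V"
  shows "(\<lambda>i. u i * v i) summable_on UNIV"
proof -
  have "(\<lambda>i. norm (u i * v i)) summable_on UNIV"
  proof (rule Infinite_Sum.abs_summable_on_comparison_test')
    show "(\<lambda>i. (u i)\<^sup>2 + (v i)\<^sup>2) summable_on UNIV"
      by (intro summable_on_add l2_summable assms)
    show "norm (u i * v i) \<le> (u i)\<^sup>2 + (v i)\<^sup>2" for i
    proof -
      have "2 * (\<bar>u i\<bar> * \<bar>v i\<bar>) \<le> (u i)\<^sup>2 + (v i)\<^sup>2"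
        using sum_squares_bound[of "\<bar>u i\<bar>" "\<bar>v i\<bar>"] by (simp add: mult.assoc)
      moreover have "0 \<le> \<bar>u i\<bar> * \<bar>v i\<bar>" by simp
      ultimately show ?thesis unfolding real_norm_def abs_mult by linarith
    qed
  qed
  then show ?thesis using summable_on_iff_abs_summable_on_real by blast
qed

definition l2_inner :: "('i \<Rightarrow> real) \<Rightarrow> ('i \<Rightarrow> real) \<Rightarrow> real" where
  "l2_inner u v = (\<Sum>\<^sub>\<infinity>i. u i * v i)"

lemma l2_nrm_eq:
  assumes v: "v \<in> l2.V"
  shows "l2.nrm v = sqrt (l2_inner v v)"
proof (rule antisym)
  have s: "(\<lambda>i. v i * v i) summable_on UNIV" using l2_mult_summable[OF v v] .
  show "l2.nrm v \<le> sqrt (l2_inner v v)"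
  proof (rule l2.nrm_le)
    fix T :: "'a set" assume "finite T"
    then have "(\<Sum>i\<in>T. v i * v i) \<le> l2_inner v v"
      unfolding l2_inner_def by (intro finite_sum_le_infsum s) auto
    then show "L2_set v T \<le> sqrt (l2_inner v v)"
      unfolding L2_set_def by (simp add: power2_eq_square)
  qed
  have "l2_inner v v \<le> (l2.nrm v)\<^sup>2"
    unfolding l2_inner_def
  proof (rule infsum_le_finite_sums[OF s])
    fix T :: "'a set" assume "finite T"
    then show "(\<Sum>i\<in>T. v i * v i) \<le> (l2.nrm v)\<^sup>2"
      using power_mono[OF l2.q_le_nrm[OF v], of T 2] by (simp add: L2_set_power2 flip: power2_eq_square)
  qed
  then show "sqrt (l2_inner v v) \<le> l2.nrm v"
    using l2.nrm_nonneg[OF v] by (intro real_le_lsqrt) auto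
qed

text \<open>\<open>hilbert_space_on\<close> demands the norm \<open>sqrt (ip x x)\<close>, which
  \<open>l2_nrm_eq\<close> identifies with \<open>l2.nrm\<close> on the carrier. Completeness is
  therefore transferred between norms that agree there.\<close>

lemma banach_space_on_cong:
  assumes b: "banach_space_on V add smul z nrm" and eq: "\<And>x. x \<in> V \<Longrightarrow> nrm' x = nrm x"
  shows "banach_space_on V add smul z nrm'"
proof -
  have vs: "real_vector_space_on V add smul z" using b by (simp add: banach_space_on_def)
  then have cl: "\<And>x y. x \<in> V \<Longrightarrow> y \<in> V \<Longrightarrow> add x y \<in> V" "\<And>a x. x \<in> V \<Longrightarrow> smul a x \<in> V"
    by (simp_all add: real_vector_space_on_def)
  have comp: "\<exists>l\<in>V. (\<lambda>n. nrm' (add (s n) (smul (-1) l))) \<longlonglongrightarrow> 0"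
    if s: "\<forall>n. s n \<in> V" and c: "\<forall>e>0. \<exists>N. \<forall>m\<ge>N. \<forall>n\<ge>N. nrm' (add (s m) (smul (-1) (s n))) < e"
    for s :: "nat \<Rightarrow> 'a"
  proof -
    have "\<forall>e>0. \<exists>N. \<forall>m\<ge>N. \<forall>n\<ge>N. nrm (add (s m) (smul (-1) (s n))) < e"
      using c s by (simp add: eq cl)
    then obtain l where "l \<in> V" "(\<lambda>n. nrm (add (s n) (smul (-1) l))) \<longlonglongrightarrow> 0"
      using b s unfolding banach_space_on_def by blast
    then show ?thesis using s by (intro bexI[of _ l]) (simp_all add: eq cl)
  qed
  have "\<forall>s. (\<forall>n. s n \<in> V) \<and>
      (\<forall>e>0. \<exists>N. \<forall>m\<ge>N. \<forall>n\<ge>N. nrm' (add (s m) (smul (-1) (s n))) < e) \<longrightarrow>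
      (\<exists>l\<in>V. (\<lambda>n. nrm' (add (s n) (smul (-1) l))) \<longlonglongrightarrow> 0)"
    using comp by blast
  moreover have "(\<forall>x\<in>V. 0 \<le> nrm' x) \<and> (\<forall>x\<in>V. nrm' x = 0 \<longleftrightarrow> x = z) \<and>
      (\<forall>a. \<forall>x\<in>V. nrm' (smul a x) = \<bar>a\<bar> * nrm' x) \<and>
      (\<forall>x\<in>V. \<forall>y\<in>V. nrm' (add x y) \<le> nrm' x + nrm' y)"
    using b by (simp add: banach_space_on_def eq cl)
  ultimately show ?thesis using vs unfolding banach_space_on_def by blast
qed

text \<open>The norm enters only through the bounds on functionals, which are taken over
  \<open>V\<close>.\<close>

lemma weak_topology_on_cong:
  assumes "\<And>x. x \<in> V \<Longrightarrow> nrm' x = nrm x"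
  shows "weak_topology_on V add smul nrm' = weak_topology_on V add smul nrm"
proof -
  have "dual_space_on V add smul nrm' = dual_space_on V add smul nrm"
    using assms by (simp add: dual_space_on_def)
  then show ?thesis by (simp add: weak_topology_on_def)
qed

lemma l2_hilbert: "hilbert_space_on l2.V fun_add fun_smul (\<lambda>i. 0) l2_inner"
  unfolding hilbert_space_on_def
proof (intro conjI ballI allI)
  show "real_vector_space_on l2.V fun_add fun_smul (\<lambda>i. 0)" by (rule l2.real_vector_space)
  show "banach_space_on l2.V fun_add fun_smul (\<lambda>i. 0) (\<lambda>x. sqrt (l2_inner x x))"
    by (rule banach_space_on_cong[OF l2.banach]) (simp add: l2_nrm_eq)
next
  fix x y w :: "'a \<Rightarrow> real" and a :: real assume x: "x \<in> l2.V" and y: "y \<in> l2.V"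
  show "l2_inner x y = l2_inner y x" by (simp add: l2_inner_def mult.commute)
  show "l2_inner (fun_smul a x) y = a * l2_inner x y"
    by (simp add: l2_inner_def mult.assoc infsum_cmult_right')
  show "l2_inner (fun_add x y) w = l2_inner x w + l2_inner y w" if "w \<in> l2.V"
    unfolding l2_inner_def
    using infsum_add[OF l2_mult_summable[OF x that] l2_mult_summable[OF y that]]
    by (simp add: distrib_right)
next
  fix x :: "'a \<Rightarrow> real" assume x: "x \<in> l2.V"
  show nonneg: "0 \<le> l2_inner x x" unfolding l2_inner_def by (rule infsum_nonneg) simp
  show "(l2_inner x x = 0) = (x = (\<lambda>i. 0))"
    using l2.nrm_eq_0_iff[OF x] l2_nrm_eq[OF x] by simp
qed

section \<open>Embeddings given by separating families\<close>

lemma inj_on_levels: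
  assumes "\<And>x y. x \<in> A \<Longrightarrow> y \<in> A \<Longrightarrow> x \<noteq> y \<Longrightarrow> \<exists>n U. \<phi> n U x \<noteq> (\<phi> n U y :: real)"
    and "\<And>n. c n \<noteq> 0"
  shows "inj_on (\<lambda>x (n, U). c n * \<phi> n U x) A"
proof (rule inj_onI, rule ccontr)
  fix x y assume xy: "x \<in> A" "y \<in> A" "x \<noteq> y"
    and eq: "(\<lambda>(n, U). c n * \<phi> n U x) = (\<lambda>(n, U). c n * \<phi> n U y)"
  obtain n U where "\<phi> n U x \<noteq> \<phi> n U y" using assms(1)[OF xy] by blast
  then show False using fun_cong[OF eq, of "(n, U)"] assms(2)[of n] by simp
qed

lemma finite_level_support:
  assumes "finite {U. \<phi> n U x \<noteq> (0::real)}"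
  shows "finite {i. fst i = n \<and> (case i of (n, U) \<Rightarrow> c n * \<phi> n U x) \<noteq> 0}"
  by (rule finite_subset[OF _ finite_imageI[OF assms, of "Pair n"]]) auto

text \<open>Coordinates are pairs of a level and a set, which is the index type fixed in
  \<open>eberlein_compact\<close>, so the level is \<open>fst\<close>. In the maximum norm the
  weight \<open>(1/2) ^ n\<close> bounds a level regardless of how many of its coordinates are
  non-zero.\<close>

lemma eberlein_compact_if_point_finite_separation:
  fixes \<phi> :: "nat \<Rightarrow> 'a set \<Rightarrow> 'a \<Rightarrow> real"
  assumes cpt: "compact_space X"
    and cont: "\<And>n U. continuous_map X (top_of_set {0..1}) (\<phi> n U)"
    and fin: "\<And>n x. x \<in> topspace X \<Longrightarrow> finite {U. \<phi> n U x \<noteq> 0}"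
    and sep: "\<And>x y. x \<in> topspace X \<Longrightarrow> y \<in> topspace X \<Longrightarrow> x \<noteq> y \<Longrightarrow>
      \<exists>n U. \<phi> n U x \<noteq> \<phi> n U y"
  shows "eberlein_compact X"
proof -
  define \<Phi> where "\<Phi> x = (\<lambda>(n, U). (1/2) ^ n * \<phi> n U x)" for x
  have cont': "continuous_map X euclideanreal (\<phi> n U)" for n U
    using cont continuous_map_into_fulltopology by blast
  have range: "0 \<le> \<phi> n U x \<and> \<phi> n U x \<le> 1" if "x \<in> topspace X" for n U x
    using cont[of n U] that by (auto simp: continuous_map_in_subtopology)
  have "\<exists>K\<subseteq>(c0.V :: (nat \<times> 'a set \<Rightarrow> real) set).
      compactin c0.weak K \<and> X homeomorphic_space subtopology c0.weak K"
  proof (rule c0.weakly_compact_image_levels[of X \<Phi> fst, OF cpt])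
    show "continuous_map X euclideanreal (\<lambda>x. \<Phi> x i)" for i
      using cont' by (cases i) (simp add: \<Phi>_def continuous_map_real_mult_left)
    show "inj_on \<Phi> (topspace X)"
      unfolding \<Phi>_def by (rule inj_on_levels[OF sep]) auto
    show "max_on T (\<Phi> x) \<le> (1/2) ^ n"
      if "x \<in> topspace X" "finite T" "\<And>i. i \<in> T \<Longrightarrow> fst i = n" for x n T
      unfolding max_on_le_iff[OF that(2)]
      using range[OF that(1)] that(3) by (fastforce simp: \<Phi>_def abs_mult mult_left_le)
    show "finite {i. fst i = n \<and> \<Phi> x i \<noteq> 0}" if "x \<in> topspace X" for x n
      unfolding \<Phi>_def using fin[OF that] by (rule finite_level_support[of \<phi>])
  qed
  then show ?thesis unfolding eberlein_compact_def using c0.banach by blast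
qed

text \<open>In the Euclidean norm the size of a level grows with the number of its non-zero
  coordinates. A single weight works for all points because \<open>b n\<close> bounds that number at
  every x.\<close>

lemma uniform_eberlein_compact_if_boundedly_point_finite_separation:
  fixes \<phi> :: "nat \<Rightarrow> 'a set \<Rightarrow> 'a \<Rightarrow> real"
  assumes cpt: "compact_space X"
    and cont: "\<And>n U. continuous_map X (top_of_set {0..1}) (\<phi> n U)"
    and fin: "\<And>n x. x \<in> topspace X \<Longrightarrow> finite {U. \<phi> n U x \<noteq> 0} \<and> card {U. \<phi> n U x \<noteq> 0} \<le> b n"
    and sep: "\<And>x y. x \<in> topspace X \<Longrightarrow> y \<in> topspace X \<Longrightarrow> x \<noteq> y \<Longrightarrow>
      \<exists>n U. \<phi> n U x \<noteq> \<phi> n U y"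
  shows "uniform_eberlein_compact X"
proof -
  \<comment> \<open>At most \<open>b n\<close> coordinates of level n are non-zero, each at most
    \<open>c n\<close>, so even their sum is at most \<open>(1/2) ^ n\<close>. The summand 1 guards
    against \<open>b n = 0\<close>.\<close>
  define c where "c n = (1/2) ^ n / (real (b n) + 1)" for n
  have c: "c n > 0" for n by (simp add: c_def add_nonneg_pos)
  define \<Phi> where "\<Phi> x = (\<lambda>(n, U). c n * \<phi> n U x)" for x
  have cont': "continuous_map X euclideanreal (\<phi> n U)" for n U
    using cont continuous_map_into_fulltopology by blast
  have range: "0 \<le> \<phi> n U x \<and> \<phi> n U x \<le> 1" if "x \<in> topspace X" for n U x
    using cont[of n U] that by (auto simp: continuous_map_in_subtopology)
  have K: "\<exists>K\<subseteq>(l2.V :: (nat \<times> 'a set \<Rightarrow> real) set).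
      compactin l2.weak K \<and> X homeomorphic_space subtopology l2.weak K"
  proof (rule l2.weakly_compact_image_levels[of X \<Phi> fst, OF cpt])
    show "continuous_map X euclideanreal (\<lambda>x. \<Phi> x i)" for i
      using cont' by (cases i) (simp add: \<Phi>_def continuous_map_real_mult_left)
    show "inj_on \<Phi> (topspace X)"
      unfolding \<Phi>_def using c by (intro inj_on_levels[OF sep]) (auto simp: less_imp_neq[symmetric])
    show "L2_set (\<Phi> x) T \<le> (1/2) ^ n"
      if x: "x \<in> topspace X" and T: "finite T" "\<And>i. i \<in> T \<Longrightarrow> fst i = n" for x n T
    proof -
      let ?A = "{U. \<phi> n U x \<noteq> 0}"
      have "L2_set (\<Phi> x) T \<le> (\<Sum>i\<in>T. \<bar>\<Phi> x i\<bar>)" by (rule L2_set_le_sum_abs)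
      also have "\<dots> = (\<Sum>i\<in>T \<inter> Pair n ` ?A. \<bar>\<Phi> x i\<bar>)"
        using T by (intro sum.mono_neutral_right) (auto simp: \<Phi>_def)
      also have "\<dots> \<le> (\<Sum>i\<in>T \<inter> Pair n ` ?A. c n)"
        using range[OF x] c[of n] by (intro sum_mono) (auto simp: \<Phi>_def abs_mult mult_left_le)
      also have "\<dots> = real (card (T \<inter> Pair n ` ?A)) * c n" by simp
      also have "card (T \<inter> Pair n ` ?A) \<le> card (Pair n ` ?A)"
        using fin[OF x] by (intro card_mono) auto
      also have "card (Pair n ` ?A) \<le> b n" using fin[OF x, of n] card_image_le by (meson order_trans)
      finally have "L2_set (\<Phi> x) T \<le> real (b n) * c n" using c[of n] by (simp add: mult_right_mono)
      also have "\<dots> = (1/2) ^ n * (real (b n) / (real (b n) + 1))" by (simp add: c_def)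
      also have "\<dots> \<le> (1/2) ^ n" by (intro mult_left_le) simp_all
      finally show ?thesis .
    qed
    show "finite {i. fst i = n \<and> \<Phi> x i \<noteq> 0}" if "x \<in> topspace X" for x n
      unfolding \<Phi>_def using fin[OF that] by (intro finite_level_support[of \<phi>]) blast
  qed
  have weak: "weak_topology_on l2.V fun_add fun_smul (\<lambda>x. sqrt (l2_inner x x)) = l2.weak"
    by (rule weak_topology_on_cong) (simp add: l2_nrm_eq)
  obtain K where "K \<subseteq> (l2.V :: (nat \<times> 'a set \<Rightarrow> real) set)" "compactin l2.weak K"
    "X homeomorphic_space subtopology l2.weak K"
    using K by blast
  then show ?thesis
    unfolding uniform_eberlein_compact_def
    by (intro exI[of _ l2.V] exI[of _ fun_add] exI[of _ fun_smul] exI[of _ "\<lambda>i. 0"]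
        exI[of _ l2_inner] exI[of _ K] conjI l2_hilbert) (simp_all add: weak)
qed

section \<open>Unions of two subspaces\<close>

text \<open>This family accommodates the functions that separate the common closure, whose supports
  are not confined to base sets.\<close>

lemma boundedly_point_finite_singleton: "boundedly_point_finite {A}"
  unfolding boundedly_point_finite_def
\<comment> \<open>The order bound is 1, so that two members are asked for and none exist; with 0 the
  set \<open>A\<close> itself would have to be empty.\<close>
proof (intro exI[of _ 1] allI impI)
  fix \<F> assume "\<F> \<subseteq> {A} \<and> finite \<F> \<and> card \<F> = 1 + 1"
  then show "\<Inter>\<F> = {}" using card_mono[of "{A}" \<F>] by simp
qed

text \<open>As \<open>card\<close> is 0 on infinite sets, this bound is used together with the
  finiteness that strong point-finiteness provides.\<close>

lemma boundedly_point_finite_card: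
  assumes "boundedly_point_finite G"
  shows "\<exists>N. \<forall>x. card {U \<in> G. x \<in> U} \<le> N"
proof -
  obtain N where N: "\<And>\<F>. \<F> \<subseteq> G \<Longrightarrow> finite \<F> \<Longrightarrow> card \<F> = N + 1 \<Longrightarrow> \<Inter>\<F> = {}"
    using assms unfolding boundedly_point_finite_def by blast
  have "card {U \<in> G. x \<in> U} \<le> N" for x
  proof (rule ccontr)
    assume "\<not> card {U \<in> G. x \<in> U} \<le> N"
    then have "N + 1 \<le> card {U \<in> G. x \<in> U}" by simp
    then obtain \<F> where F: "\<F> \<subseteq> {U \<in> G. x \<in> U}" "card \<F> = N + 1" "finite \<F>"
      by (rule obtain_subset_with_card_n)
    then have "\<Inter>\<F> = {}" using N[of \<F>] by blast
    moreover have "x \<in> \<Inter>\<F>" using F by blast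
    ultimately show False by blast
  qed
  then show ?thesis by blast
qed

text \<open>\<open>H n\<close> is the family in which the supports of level n lie; finiteness
  conditions on \<open>H\<close> are kept out, so that the same notion serves both kinds of
  compacta.\<close>

definition separates_within ::
  "'a topology \<Rightarrow> (nat \<Rightarrow> 'a set set) \<Rightarrow> (nat \<Rightarrow> 'a set \<Rightarrow> 'a \<Rightarrow> real) \<Rightarrow> bool" where
  "separates_within X H \<psi> \<longleftrightarrow>
    (\<forall>n U. continuous_map X (top_of_set {0..1}) (\<psi> n U)) \<and>
    (\<forall>n U. \<forall>x\<in>topspace X. \<psi> n U x \<noteq> 0 \<longrightarrow> U \<in> H n \<and> x \<in> U) \<and>
    (\<forall>x\<in>topspace X. \<forall>y\<in>topspace X. x \<noteq> y \<longrightarrow> (\<exists>n U. \<psi> n U x \<noteq> \<psi> n U y))"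

lemma separates_withinD:
  assumes "separates_within X H \<psi>"
  shows "continuous_map X (top_of_set {0..1}) (\<psi> n U)"
    and "x \<in> topspace X \<Longrightarrow> \<psi> n U x \<noteq> 0 \<Longrightarrow> U \<in> H n \<and> x \<in> U"
    and "x \<in> topspace X \<Longrightarrow> y \<in> topspace X \<Longrightarrow> x \<noteq> y \<Longrightarrow> \<exists>n U. \<psi> n U x \<noteq> \<psi> n U y"
  using assms by (simp_all add: separates_within_def)

text \<open>Each \<open>H n\<close> is literally one of the given families or a singleton, so any
  bound on the order of those families remains available to the uniform case.\<close>

lemma separating_family_of_union:
  assumes cpt: "compact_space X" and haus: "Hausdorff_space X"
    and Y1: "Y1 \<subseteq> topspace X" and Y2: "Y2 \<subseteq> topspace X" and cover: "topspace X = Y1 \<union> Y2"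
    and B1: "is_base (subtopology X Y1) B1" "B1 = (\<Union>n. G1 n)" "\<And>n::nat. strongly_point_finite (G1 n)"
    and B2: "is_base (subtopology X Y2) B2" "B2 = (\<Union>n. G2 n)" "\<And>n::nat. strongly_point_finite (G2 n)"
  shows "metrizable_space (subtopology X (X closure_of Y1 \<inter> X closure_of Y2))"
    and "\<exists>\<psi> H. (\<forall>n. H n \<in> range G1 \<union> range G2 \<union> {{topspace X}}) \<and> separates_within X H \<psi>"
proof -
  let ?C1 = "X closure_of Y1" and ?C2 = "X closure_of Y2"
  have reg: "regular_space X" using compact_Hausdorff_imp_regular_space[OF cpt haus] .
  have "sigma_strongly_point_finite B1" "sigma_strongly_point_finite B2"
    unfolding sigma_strongly_point_finite_def using B1(2,3) B2(2,3) by blast+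
  then obtain B where B: "is_base (subtopology X (?C1 \<inter> ?C2)) B"
    "\<forall>x\<in>?C1 \<inter> ?C2. countable {U \<in> B. x \<in> U}"
    using point_countable_base_on_common_closure[OF reg Y1 Y2 cover B1(1) _ B2(1)] by metis
  have clF: "closedin X (?C1 \<inter> ?C2)" by (intro closedin_Int closedin_closure_of)
  show "metrizable_space (subtopology X (?C1 \<inter> ?C2))"
    using metrizable_if_point_countable_base[OF cpt haus clF B(1)] B(2) by blast
  have "\<exists>g :: nat \<Rightarrow> 'a \<Rightarrow> real. (\<forall>n. continuous_map X (top_of_set {0..1}) (g n)) \<and>
      (\<forall>x\<in>?C1 \<inter> ?C2. \<forall>y\<in>?C1 \<inter> ?C2. x \<noteq> y \<longrightarrow> (\<exists>n. g n x \<noteq> g n y))"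
    by (rule countable_separating_functions[OF cpt haus clF B(1)]) (use B(2) in blast)+
  then obtain g :: "nat \<Rightarrow> 'a \<Rightarrow> real"
    where g: "\<forall>n. continuous_map X (top_of_set {0..1}) (g n)"
      "\<forall>x\<in>?C1 \<inter> ?C2. \<forall>y\<in>?C1 \<inter> ?C2. x \<noteq> y \<longrightarrow> (\<exists>n. g n x \<noteq> g n y)" by blast
  have sub: "Y1 \<subseteq> ?C1" "Y2 \<subseteq> ?C2" using Y1 Y2 closure_of_subset by blast+
  have D: "openin X (topspace X - ?C2)" "topspace X - ?C2 \<subseteq> Y1"
    "openin X (topspace X - ?C1)" "topspace X - ?C1 \<subseteq> Y2"
    using cover sub by (blast intro: openin_diff closedin_closure_of openin_topspace)+
  define P where "P \<phi> G D \<longleftrightarrow>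
      (\<forall>n k U. continuous_map X (top_of_set {0..1}) (\<phi> n k U)) \<and>
      (\<forall>n k U. \<forall>x\<in>topspace X. \<phi> n k U x \<noteq> 0 \<longrightarrow> U \<in> G n \<and> x \<in> U) \<and>
      (\<forall>x\<in>D. \<forall>y\<in>topspace X. y \<noteq> x \<longrightarrow> (\<exists>n k U. \<phi> n k U x \<noteq> \<phi> n k U y))"
    for \<phi> :: "nat \<Rightarrow> nat \<Rightarrow> 'a set \<Rightarrow> 'a \<Rightarrow> real" and G D
  have ex: "\<exists>\<phi>. P \<phi> G D"
    if "is_base (subtopology X Y) A" "A = (\<Union>n. G n)" "\<And>n::nat. strongly_point_finite (G n)"
      "openin X D" "D \<subseteq> Y" for Y A G D
    unfolding P_def by (rule separating_functions_on_open[OF cpt haus that]) blast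
  obtain \<phi>1 where P1: "P \<phi>1 G1 (topspace X - ?C2)" using ex[OF B1 D(1,2)] by blast
  obtain \<phi>2 where P2: "P \<phi>2 G2 (topspace X - ?C1)" using ex[OF B2 D(3,4)] by blast
  note \<phi>1 = P1[unfolded P_def, THEN conjunct1] P1[unfolded P_def, THEN conjunct2, THEN conjunct1]
    P1[unfolded P_def, THEN conjunct2, THEN conjunct2]
  note \<phi>2 = P2[unfolded P_def, THEN conjunct1] P2[unfolded P_def, THEN conjunct2, THEN conjunct1]
    P2[unfolded P_def, THEN conjunct2, THEN conjunct2]
  \<comment> \<open>The first index tells the three sources of functions apart. The index k of the
    closed parts belongs to the level, so each level has one function per set and keeps the family
    \<open>G1 m\<close> or \<open>G2 m\<close>.\<close>
  define H' where "H' = (\<lambda>(a::nat, m, k::nat).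
    if a = 0 then G1 m else if a = 1 then G2 m else {topspace X})"
  \<comment> \<open>The function \<open>g m\<close> occupies the single coordinate
    \<open>topspace X\<close> of its level; the other coordinates there are zero.\<close>
  define \<psi>' where "\<psi>' = (\<lambda>(a::nat, m, k) U.
    if a = 0 then \<phi>1 m k U else if a = 1 then \<phi>2 m k U
    else if U = topspace X then g m else (\<lambda>_. 0))"
  have H': "H' j \<in> range G1 \<union> range G2 \<union> {{topspace X}}" for j
    by (cases j) (simp add: H'_def)
  have c': "continuous_map X (top_of_set {0..1}) (\<psi>' j U)" for j U
    using \<phi>1(1) \<phi>2(1) g(1) by (cases j) (simp add: \<psi>'_def)
  have s': "U \<in> H' j \<and> x \<in> U" if x: "x \<in> topspace X" and nz: "\<psi>' j U x \<noteq> 0" for j U x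
  proof -
    obtain a m k where j: "j = (a, m, k)" by (cases j)
    consider "a = 0" | "a = 1" | "a \<noteq> 0" "a \<noteq> 1" by blast
    then show ?thesis
    proof cases
      case 1
      then show ?thesis using \<phi>1(2)[rule_format, OF x, of m k U] nz by (simp add: j \<psi>'_def H'_def)
    next
      case 2
      then show ?thesis using \<phi>2(2)[rule_format, OF x, of m k U] nz by (simp add: j \<psi>'_def H'_def)
    next
      case 3
      then show ?thesis using x nz by (simp add: j \<psi>'_def H'_def split: if_splits)
    qed
  qed
  have sep1: "\<exists>j U. \<psi>' j U x \<noteq> \<psi>' j U y"
    if x: "x \<in> topspace X - (?C1 \<inter> ?C2)" and y: "y \<in> topspace X" "y \<noteq> x" for x y
  proof (cases "x \<in> ?C2")
    case True
    then obtain n k U where "\<phi>2 n k U x \<noteq> \<phi>2 n k U y" using \<phi>2(3) x y by blast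
    then show ?thesis by (intro exI[of _ "(1, n, k)"] exI[of _ U]) (simp add: \<psi>'_def)
  next
    case False
    then obtain n k U where "\<phi>1 n k U x \<noteq> \<phi>1 n k U y" using \<phi>1(3) x y by blast
    then show ?thesis by (intro exI[of _ "(0, n, k)"] exI[of _ U]) (simp add: \<psi>'_def)
  qed
  have sep': "\<exists>j U. \<psi>' j U x \<noteq> \<psi>' j U y"
    if x: "x \<in> topspace X" and y: "y \<in> topspace X" and xy: "x \<noteq> y" for x y
  proof (cases "x \<in> ?C1 \<inter> ?C2 \<and> y \<in> ?C1 \<inter> ?C2")
    case True
    then obtain n where "g n x \<noteq> g n y" using g(2) xy by blast
    then show ?thesis
      by (intro exI[of _ "(2, n, 0)"] exI[of _ "topspace X"]) (simp add: \<psi>'_def)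
  next
    case False
    \<comment> \<open>One point off the common closure is enough, since \<open>sep1\<close>
      separates it from every other point; the remaining pairs were left to
      \<open>g\<close>.\<close>
    then consider "x \<in> topspace X - (?C1 \<inter> ?C2)" | "y \<in> topspace X - (?C1 \<inter> ?C2)"
      using x y by blast
    then show ?thesis
    proof cases
      case 1
      then show ?thesis using sep1[OF 1 y] xy by blast
    next
      case 2
      then show ?thesis using sep1[OF 2 x] xy by metis
    qed
  qed
  \<comment> \<open>\<open>from_nat\<close> recodes triples as natural numbers; repeated levels do
    no harm.\<close>
  define \<psi> where "\<psi> n = \<psi>' (from_nat n)" for n :: nat
  define H where "H n = H' (from_nat n)" for n :: nat
  have sep: "\<exists>n U. \<psi> n U x \<noteq> \<psi> n U y"
    if xy: "x \<in> topspace X" "y \<in> topspace X" "x \<noteq> y" for x y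
  proof -
    obtain j U where "\<psi>' j U x \<noteq> \<psi>' j U y" using sep'[OF xy] by blast
    then show ?thesis by (intro exI[of _ "to_nat j"] exI[of _ U]) (simp add: \<psi>_def)
  qed
  show "\<exists>\<psi> H. (\<forall>n. H n \<in> range G1 \<union> range G2 \<union> {{topspace X}}) \<and> separates_within X H \<psi>"
    unfolding separates_within_def
  proof (intro exI[of _ \<psi>] exI[of _ H] conjI allI ballI impI)
    show "H n \<in> range G1 \<union> range G2 \<union> {{topspace X}}" for n unfolding H_def by (rule H')
    show "continuous_map X (top_of_set {0..1}) (\<psi> n U)" for n U unfolding \<psi>_def by (rule c')
    show "U \<in> H n" "x \<in> U" if "x \<in> topspace X" "\<psi> n U x \<noteq> 0" for n U x
      using s'[of x "from_nat n" U] that by (simp_all add: \<psi>_def H_def)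
  qed (use sep in blast)
qed

lemma eberlein_compact_union:
  assumes X: "compact_space X" "Hausdorff_space X" "X1 \<subseteq> topspace X" "X2 \<subseteq> topspace X"
      "topspace X = X1 \<union> X2"
    and base: "is_base (subtopology X X1) B1" "is_base (subtopology X X2) B2"
    and sigma: "sigma_strongly_point_finite B1" "sigma_strongly_point_finite B2"
  shows "metrizable_space (subtopology X (X closure_of X1 \<inter> X closure_of X2))"
    and "eberlein_compact X"
proof -
  obtain G1 G2 :: "nat \<Rightarrow> 'a set set"
    where G1: "B1 = (\<Union>n. G1 n)" "\<forall>n. strongly_point_finite (G1 n)"
      and G2: "B2 = (\<Union>n. G2 n)" "\<forall>n. strongly_point_finite (G2 n)"
    using sigma unfolding sigma_strongly_point_finite_def by blast
  note sep = separating_family_of_union[OF X base(1) G1(1) G1(2)[rule_format]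
      base(2) G2(1) G2(2)[rule_format]]
  show "metrizable_space (subtopology X (X closure_of X1 \<inter> X closure_of X2))" by (rule sep(1))
  obtain \<psi> H where H: "\<forall>n. H n \<in> range G1 \<union> range G2 \<union> {{topspace X}}"
    and "separates_within X H \<psi>"
    using sep(2) by blast
  note sw = separates_withinD[OF this(2)]
  have "strongly_point_finite (H n)" for n
    using H[rule_format, of n] G1(2) G2(2)
      boundedly_imp_strongly_point_finite[OF boundedly_point_finite_singleton]
    by (elim UnE rangeE singletonE) auto
  then have pf: "finite {U \<in> H n. x \<in> U}" for n x
    by (rule strongly_point_finite_imp_point_finite)
  show "eberlein_compact X"
  proof (rule eberlein_compact_if_point_finite_separation[OF X(1), of \<psi>])
    show "finite {U. \<psi> n U x \<noteq> 0}" if "x \<in> topspace X" for n x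
      using sw(2)[OF that] by (intro finite_subset[OF _ pf[of n x]]) blast
  qed (use sw(1,3) in blast)+
qed

lemma uniform_eberlein_compact_union:
  assumes X: "compact_space X" "Hausdorff_space X" "X1 \<subseteq> topspace X" "X2 \<subseteq> topspace X"
      "topspace X = X1 \<union> X2"
    and base: "is_base (subtopology X X1) B1" "is_base (subtopology X X2) B2"
    and sigma: "sigma_boundedly_point_finite B1" "sigma_boundedly_point_finite B2"
  shows "metrizable_space (subtopology X (X closure_of X1 \<inter> X closure_of X2))"
    and "uniform_eberlein_compact X"
proof -
  obtain G1 G2 :: "nat \<Rightarrow> 'a set set"
    where G1: "B1 = (\<Union>n. G1 n)" "\<forall>n. boundedly_point_finite (G1 n)"
      and G2: "B2 = (\<Union>n. G2 n)" "\<forall>n. boundedly_point_finite (G2 n)"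
    using sigma unfolding sigma_boundedly_point_finite_def by blast
  note sep = separating_family_of_union[OF X
      base(1) G1(1) boundedly_imp_strongly_point_finite[OF G1(2)[rule_format]]
      base(2) G2(1) boundedly_imp_strongly_point_finite[OF G2(2)[rule_format]]]
  show "metrizable_space (subtopology X (X closure_of X1 \<inter> X closure_of X2))" by (rule sep(1))
  obtain \<psi> H where H: "\<forall>n. H n \<in> range G1 \<union> range G2 \<union> {{topspace X}}"
    and "separates_within X H \<psi>"
    using sep(2) by blast
  note sw = separates_withinD[OF this(2)]
  have bH: "boundedly_point_finite (H n)" for n
    using H[rule_format, of n] G1(2) G2(2) boundedly_point_finite_singleton
    by (elim UnE rangeE singletonE) auto
  have "\<exists>N. \<forall>x. card {U \<in> H n. x \<in> U} \<le> N" for n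
    by (rule boundedly_point_finite_card[OF bH])
  then obtain b where b: "\<And>n x. card {U \<in> H n. x \<in> U} \<le> b n" by metis
  have pf: "finite {U \<in> H n. x \<in> U}" for n x
    using strongly_point_finite_imp_point_finite[OF boundedly_imp_strongly_point_finite[OF bH]] .
  show "uniform_eberlein_compact X"
  proof (rule uniform_eberlein_compact_if_boundedly_point_finite_separation[OF X(1), of \<psi> b])
    show "finite {U. \<psi> n U x \<noteq> 0} \<and> card {U. \<psi> n U x \<noteq> 0} \<le> b n" if "x \<in> topspace X" for n x
    proof -
      have "{U. \<psi> n U x \<noteq> 0} \<subseteq> {U \<in> H n. x \<in> U}" using sw(2)[OF that] by blast
      then show ?thesis using pf[of n x] b[of n x] by (meson card_mono finite_subset order_trans)
    qed
  qed (use sw(1,3) in blast)+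
qed

theorem theorem3p6:
  fixes X :: "'a topology" and X1 X2 :: "'a set"
  assumes "compact_space X" and "Hausdorff_space X"
    and "X1 \<subseteq> topspace X" and "X2 \<subseteq> topspace X"
    and "topspace X = X1 \<union> X2"
  shows "((\<exists>B1. is_base (subtopology X X1) B1 \<and> sigma_strongly_point_finite B1) \<and>
          (\<exists>B2. is_base (subtopology X X2) B2 \<and> sigma_strongly_point_finite B2)
          \<longrightarrow> metrizable_space (subtopology X (X closure_of X1 \<inter> X closure_of X2))
              \<and> eberlein_compact X)
       \<and> ((\<exists>B1. is_base (subtopology X X1) B1 \<and> sigma_boundedly_point_finite B1) \<and>
          (\<exists>B2. is_base (subtopology X X2) B2 \<and> sigma_boundedly_point_finite B2)
          \<longrightarrow> metrizable_space (subtopology X (X closure_of X1 \<inter> X closure_of X2))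
              \<and> uniform_eberlein_compact X)"
  using eberlein_compact_union[OF assms] uniform_eberlein_compact_union[OF assms] by blast

end
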